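(* Let $d\ge 3$ and let $(r_n)$ be any sequence with $r_n\uparrow\infty$ such that $\limsup_{n\to\infty}\frac{\log r_n}{\log n}\le \frac12$. Then, for the simple symmetric random walk on $\mathbb{Z}^d$ started at the origin, $$\lim_{n\to\infty}\frac{\xi^{(d)}_{B(r_n)}(n)}{\log r_n}=2\lambda_d\qquad\text{almost surely}.$$
   Context: The simple symmetric random walk on $\mathbb{Z}^d$ is $\mathbf{S}_0=\mathbf{0}$, $\mathbf{S}_n=\sum_{k=1}^n\mathbf{X}_k$, where $\mathbf{X}_1,\mathbf{X}_2,\dots$ are i.i.d. with $\mathbf{P}(\mathbf{X}_1=\mathbf{e}_i)=\mathbf{P}(\mathbf{X}_1=-\mathbf{e}_i)=\frac1{2d}$ for $i=1,\dots,d$, and $\mathbf{e}_1,\dots,\mathbf{e}_d$ are the standard unit vectors of $\mathbb{Z}^d$. Its local time at $\mathbf{x}\in\mathbb{Z}^d$ is $\xi^{(d)}(\mathbf{x},n)=\#\{k:\ 0<k\le n,\ \mathbf{S}_k=\mathbf{x}\}$. For $A\subseteq\mathbb{Z}^d$, $\xi^{(d)}_A(n)=\max_{\mathbf{x}\in A}\xi^{(d)}(\mathbf{x},n)$. For $r>0$, $B(r)=\{\mathbf{x}\in\mathbb{Z}^d:\ \|\mathbf{x}\|\le r\}$, where $\|\cdot\|$ is the Euclidean norm. The $r_n$ are positive reals, and $r_n\uparrow\infty$ means that the sequence is nondecreasing and tends to infinity. For $d\ge3$, $\gamma_d=\mathbf{P}(\mathbf{S}_k\ne\mathbf{0}\text{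 for all }k\ge1)$ is the probability that the walk never returns to its starting point ($0<\gamma_d<1$), and $\lambda_d=-\dfrac{1}{\log(1-\gamma_d)}$. *)

theory Defs
  imports "HOL-Probability.Probability"
begin

text \<open>
  The lattice \<open>\<int>\<^sup>d\<close> is the type \<^typ>\<open>int ^ 'd\<close> with \<open>d = CARD('d)\<close>. The steps of the walk are
  \<open>X 1, X 2, \<dots>\<close>; the value \<open>X 0\<close> is unconstrained and never used. The \<open>2 d\<close> prescribed
  probabilities add up to 1, so they determine the law of each step.
\<close>

locale simple_random_walk = prob_space M
  for M :: "'a measure" and X :: "nat \<Rightarrow> 'a \<Rightarrow> int ^ 'd" +
  assumes indep_steps: "indep_vars (\<lambda>_. count_space UNIV) X {1..}"
    and prob_step_plus:
      "\<And>k i. k \<ge> 1 \<Longrightarrow> prob {\<omega> \<in> space M. X k \<omega> = axis i 1} = 1 / (2 * real CARD('d))"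
    and prob_step_minus:
      "\<And>k i. k \<ge> 1 \<Longrightarrow> prob {\<omega> \<in> space M. X k \<omega> = - axis i 1} = 1 / (2 * real CARD('d))"

definition walk :: "(nat \<Rightarrow> 'a \<Rightarrow> int ^ 'd) \<Rightarrow> nat \<Rightarrow> 'a \<Rightarrow> int ^ 'd" where
  "walk X n \<omega> = (\<Sum>k=1..n. X k \<omega>)"

definition local_time :: "(nat \<Rightarrow> 'a \<Rightarrow> int ^ 'd) \<Rightarrow> int ^ 'd \<Rightarrow> nat \<Rightarrow> 'a \<Rightarrow> nat" where
  "local_time X x n \<omega> = card {k. 0 < k \<and> k \<le> n \<and> walk X k \<omega> = x}"

text \<open>
  Local times up to \<open>n\<close> are bounded by \<open>n\<close>, so the image below is finite even for infinite \<open>A\<close>;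
  the maximum is meaningful for every nonempty \<open>A\<close>.
\<close>

definition max_local_time :: "(nat \<Rightarrow> 'a \<Rightarrow> int ^ 'd) \<Rightarrow> (int ^ 'd) set \<Rightarrow> nat \<Rightarrow> 'a \<Rightarrow> nat" where
  "max_local_time X A n \<omega> = Max ((\<lambda>x. local_time X x n \<omega>) ` A)"

definition lattice_ball :: "real \<Rightarrow> (int ^ 'd) set" where
  "lattice_ball r = {x. norm (\<chi> i. real_of_int (x $ i)) \<le> r}"

definition escape_prob :: "'a measure \<Rightarrow> (nat \<Rightarrow> 'a \<Rightarrow> int ^ 'd) \<Rightarrow> real" where
  "escape_prob M X = measure M {\<omega> \<in> space M. \<forall>k\<ge>1. walk X k \<omega> \<noteq> 0}"

definition walk_lambda :: "'a measure \<Rightarrow> (nat \<Rightarrow> 'a \<Rightarrow> int ^ 'd) \<Rightarrow> real" where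
  "walk_lambda M X = - (1 / ln (1 - escape_prob M X))"

end

theory Submission
  imports Defs
begin

text \<open>
  Let \<open>q = 1 - \<gamma>\<close> be the probability of a return to the starting point, so that
  \<open>q ^ k = exp (-k / \<lambda>)\<close>, and put \<open>k = c \<lambda> log R\<close>, so that \<open>q ^ k = R powr (-c)\<close>. The number of returns is
  geometrically distributed: at any given time, the walk will return to its present position at least
  \<open>k\<close> times with probability \<open>R powr (-c)\<close>. The walk spends about \<open>R\<^sup>2\<close> units of time in the ball
  of radius \<open>R\<close>, each of which offers one chance for such a run of returns. Hence, with high probability, some point of
  the ball is visited \<open>k\<close> times if \<open>c < 2\<close>, and none if \<open>c > 2\<close>.

  For the upper bound (lemma \<open>prob_many_visits_le\<close>) the expected time spent in the ball must be
  of order \<open>R\<^sup>2\<close>. This is read off from the function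
  \<open>(a + |x|\<^sup>2) powr (-1/4)\<close>, which is superharmonic on the lattice for \<open>d \<ge> 3\<close> and large \<open>a\<close> (lemma
  \<open>step_mean_potential\<close>). With \<open>a = R\<^sup>2\<close>, a multiple of it decreases on average by at least 1 in each
  step made inside the ball, which bounds the expected time there. The same function shows
  that the walk is transient, that is \<open>q < 1\<close>.

  For the lower bound (lemma \<open>prob_no_heavy_point_le\<close>) the first \<open>R powr (2 - \<delta>)\<close> steps,
  during which the walk is unlikely to leave the ball, are cut into independent blocks of
  logarithmic length; in each block it is asked whether the walk makes \<open>k\<close> short returns to the
  starting point of the block.

  Both failure probabilities are summable over \<open>R = 2 ^ j\<close>, so the Borel-Cantelli lemma gives almost sure
  bounds along these radii (lemmas \<open>AE_local_time_le\<close> and \<open>AE_local_time_ge\<close>). The upper bound holds at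
  all times \<open>n\<close>, and the lower bound at all \<open>n\<close> that are at least \<open>R powr (2 - \<delta>/2)\<close>; the condition
  on \<open>log (r n) / log n\<close> guarantees this for large \<open>n\<close> and \<open>R \<le> r n\<close>. Monotonicity of the
  maximal local time in the ball then interpolates between the radii
  (lemma \<open>max_local_time_bounds_imp_tendsto\<close>).

  The probability estimates concern finite lists of independent uniform unit steps, and most of them
  are proved by induction on the length of the list, conditioning on the first step.
\<close>

section \<open>First-step analysis for finite paths\<close>

definition unit_steps :: "(int ^ 'd) set" where
  "unit_steps = range (\<lambda>i. axis i 1) \<union> range (\<lambda>i. - axis i 1)"

abbreviation paths :: "nat \<Rightarrow> (int ^ 'd) list pmf" where
  "paths n \<equiv> replicate_pmf n (pmf_of_set unit_steps)"

definition step_mean :: "((int ^ 'd) \<Rightarrow> real) \<Rightarrow> real" where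
  "step_mean f = (\<Sum>i\<in>UNIV. f (axis i 1) + f (- axis i 1)) / (2 * real CARD('d))"

lemma axis_neq_minus_axis: "axis i (1::int) \<noteq> - axis j 1"
proof
  assume "axis i (1::int) = - axis j 1"
  then have "axis i (1::int) $ i = (- axis j 1) $ i" by simp
  then show False by (auto simp: axis_def split: if_splits)
qed

lemma inj_axis_one: "inj (\<lambda>i. axis i (1::int))"
  by (auto simp: inj_on_def axis_eq_axis)

lemma sum_unit_steps:
  "(\<Sum>e\<in>unit_steps. f e) = (\<Sum>i\<in>(UNIV :: 'd :: finite set). f (axis i 1) + (f (- axis i 1) :: real))"
proof -
  have i2: "inj (\<lambda>i. - axis i (1::int))"
    using inj_axis_one by (auto simp: inj_on_def)
  have "(\<Sum>e\<in>unit_steps. f e) = sum f (range (\<lambda>i. axis i 1)) + sum f (range (\<lambda>i. - axis i 1))"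
    unfolding unit_steps_def
    by (intro sum.union_disjoint) (use axis_neq_minus_axis in auto)
  also have "\<dots> = (\<Sum>i\<in>UNIV. f (axis i 1)) + (\<Sum>i\<in>UNIV. f (- axis i 1))"
    using sum.reindex[OF inj_axis_one, of f] sum.reindex[OF i2, of f] by (simp add: o_def)
  finally show ?thesis by (simp add: sum.distrib)
qed

lemma finite_unit_steps [simp]: "finite unit_steps"
  and unit_steps_nonempty [simp]: "unit_steps \<noteq> {}"
  by (auto simp: unit_steps_def)

lemma card_unit_steps: "real (card (unit_steps :: (int ^ 'd) set)) = 2 * real CARD('d)"
  using sum_unit_steps[of "\<lambda>_ :: int ^ 'd. 1"] by simp

lemma step_mean_mono: "(\<And>e. f e \<le> g e) \<Longrightarrow> step_mean f \<le> step_mean g"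
  by (auto simp: step_mean_def intro!: divide_right_mono sum_mono add_mono)

lemma step_mean_const [simp]: "step_mean (\<lambda>_. c) = c"
  by (simp add: step_mean_def)

lemma step_mean_mult_left: "step_mean (\<lambda>e. c * f e) = c * step_mean f"
  by (simp add: step_mean_def sum_distrib_left distrib_left)

lemma step_mean_mult_right: "step_mean (\<lambda>e. f e * c) = step_mean f * c"
  using step_mean_mult_left[of c f] by (simp add: mult.commute)

text \<open>
  Conditioning on the first step turns most of the estimates below into inductions on the length of
  the path, in which the starting point varies.
\<close>

lemma prob_paths_Suc:
  fixes A :: "(int ^ 'd) list set"
  shows "measure_pmf.prob (paths (Suc n)) A
           = step_mean (\<lambda>e. measure_pmf.prob (paths n) {es. e # es \<in> A})"
proof -
  let ?f = "\<lambda>e. measure_pmf.prob (paths n) {es. e # es \<in> A}"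
  have eq: "replicate_pmf (Suc n) (pmf_of_set unit_steps)
          = bind_pmf (pmf_of_set unit_steps) (\<lambda>e :: int ^ 'd. map_pmf ((#) e) (paths n))"
    by (simp add: map_pmf_def)
  have "emeasure (paths (Suc n)) A = (\<integral>\<^sup>+e. ennreal (?f e) \<partial>pmf_of_set unit_steps)"
    unfolding eq emeasure_bind_pmf emeasure_map_pmf
    by (simp add: vimage_def measure_pmf.emeasure_eq_measure)
  also have "\<dots> = ennreal (measure_pmf.expectation (pmf_of_set unit_steps) ?f)"
    by (intro nn_integral_eq_integral integrable_measure_pmf_finite) auto
  also have "measure_pmf.expectation (pmf_of_set unit_steps) ?f = sum ?f unit_steps / real (card (unit_steps :: (int ^ 'd) set))"
    by (rule integral_pmf_of_set) auto
  also have "\<dots> = step_mean ?f"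
    unfolding card_unit_steps step_mean_def sum_unit_steps ..
  finally have "ennreal (measure_pmf.prob (paths (Suc n)) A) = ennreal (step_mean ?f)"
    unfolding measure_pmf.emeasure_eq_measure .
  moreover have "0 \<le> step_mean ?f"
    using step_mean_mono[of "\<lambda>_. 0" ?f] by simp
  ultimately show ?thesis by simp
qed

text \<open>
  Independence of the first \<open>m\<close> and the last \<open>n\<close> steps, in the form in which it is applied:
  to an event that is contained in a product event.
\<close>

lemma prob_paths_append_le:
  fixes A B C :: "(int ^ 'd) list set"
  assumes "\<And>es fs. es @ fs \<in> C \<Longrightarrow> length es = m \<Longrightarrow> es \<in> A \<and> fs \<in> B"
  shows "measure_pmf.prob (paths (m + n)) C
           \<le> measure_pmf.prob (paths m) A * measure_pmf.prob (paths n) B"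
proof -
  have eq: "replicate_pmf (m + n) (pmf_of_set unit_steps)
     = map_pmf (\<lambda>(es, fs). es @ fs :: (int ^ 'd) list) (pair_pmf (paths m) (paths n))"
    by (simp add: replicate_pmf_distrib pair_pmf_def map_bind_pmf)
  have "measure_pmf.prob (paths (m + n)) C
      = measure_pmf.prob (pair_pmf (paths m) (paths n)) ((\<lambda>(es, fs). es @ fs) -` C)"
    unfolding eq by simp
  also have "\<dots> \<le> measure_pmf.prob (pair_pmf (paths m) (paths n)) (A \<times> B)"
    by (rule measure_pmf.finite_measure_mono_AE)
       (use assms in \<open>auto simp: AE_measure_pmf_iff set_replicate_pmf\<close>)
  also have "\<dots> = measure_pmf.prob (paths m) A * measure_pmf.prob (paths n) B"
    by (rule measure_pmf_prob_product) auto
  finally show ?thesis .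
qed

section \<open>Successive returns\<close>

text \<open>
  The starting point is an argument because it changes in a first-step induction. As in the
  local time of the walk, the visit at time 0 is not counted.
\<close>

fun visits :: "'v :: monoid_add \<Rightarrow> 'v \<Rightarrow> 'v list \<Rightarrow> nat" where
  "visits y x [] = 0"
| "visits y x (e # es) = (if x + e = y then 1 else 0) + visits y (x + e) es"

lemma visits_append:
  "visits y x (es @ fs) = visits y x es + visits y (x + sum_list es) fs"
  by (induction es arbitrary: x) (auto simp: add.assoc)

lemma visits_translate:
  fixes y z :: "'v :: ab_group_add"
  shows "visits (y + z) (x + z) es = visits y x es"
proof (induction es arbitrary: x)
  case (Cons e es)
  have "x + z + e = (x + e) + z" by (simp add: ac_simps)
  then show ?case using Cons[of "x + e"] by (simp only: visits.simps add_right_cancel)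
qed simp

definition visit_prob :: "nat \<Rightarrow> nat \<Rightarrow> (int ^ 'd) \<Rightarrow> real" where
  "visit_prob n k x = measure_pmf.prob (paths n) {es. k \<le> visits 0 x es}"

lemma visit_prob_zero_visits [simp]: "visit_prob n 0 x = 1"
  by (simp add: visit_prob_def)

lemma visit_prob_no_steps [simp]: "visit_prob 0 (Suc k) x = 0"
  by (simp add: visit_prob_def)

lemma visit_prob_nonneg: "0 \<le> visit_prob n k x"
  by (simp add: visit_prob_def)

lemma visit_prob_le_1: "visit_prob n k x \<le> 1"
  by (simp add: visit_prob_def)

lemma visit_prob_Suc:
  fixes x :: "int ^ 'd"
  shows "visit_prob (Suc n) (Suc k) x
     = step_mean (\<lambda>e. if x + e = 0 then visit_prob n k (0 :: int ^ 'd) else visit_prob n (Suc k) (x + e))"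
  unfolding visit_prob_def prob_paths_Suc
  by (rule arg_cong[where f = step_mean]) (auto simp: fun_eq_iff)

lemma visit_prob_Suc_steps_ge: "visit_prob n k x \<le> visit_prob (Suc n) k x"
proof (induction n arbitrary: k x)
  case 0
  show ?case by (cases k) (auto simp: visit_prob_nonneg)
next
  case (Suc n)
  show ?case
  proof (cases k)
    case (Suc k')
    show ?thesis unfolding Suc
      by (subst (1 2) visit_prob_Suc, rule step_mean_mono) (use Suc.IH in auto)
  qed simp
qed

lemma visit_prob_mono: "m \<le> n \<Longrightarrow> visit_prob m k x \<le> visit_prob n k x"
  using lift_Suc_mono_le[of "\<lambda>n. visit_prob n k x"] visit_prob_Suc_steps_ge by blast

text \<open>
  After the first return to the origin at most \<open>n\<close> steps are left, so the later returns are no more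
  likely than \<open>k\<close> returns within \<open>n\<close> fresh steps. First-step induction treats all possible times of
  the first return at once.
\<close>

lemma visit_prob_Suc_le:
  fixes x :: "int ^ 'd"
  shows "visit_prob n (Suc k) x \<le> visit_prob n 1 x * visit_prob n k (0 :: int ^ 'd)"
proof (induction n arbitrary: x)
  case 0
  show ?case by simp
next
  case (Suc n)
  have "visit_prob (Suc n) (Suc k) x
      \<le> step_mean (\<lambda>e. (if x + e = 0 then 1 else visit_prob n 1 (x + e)) * visit_prob n k (0 :: int ^ 'd))"
    unfolding visit_prob_Suc by (rule step_mean_mono) (use Suc.IH in auto)
  also have "\<dots> = visit_prob (Suc n) 1 x * visit_prob n k (0 :: int ^ 'd)"
    using visit_prob_Suc[of n 0 x] by (simp add: step_mean_mult_right cong: if_cong)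
  also have "\<dots> \<le> visit_prob (Suc n) 1 x * visit_prob (Suc n) k (0 :: int ^ 'd)"
    by (intro mult_left_mono visit_prob_Suc_steps_ge visit_prob_nonneg)
  finally show ?case .
qed

lemma visit_prob_power_le:
  "visit_prob n k (0 :: int ^ 'd) \<le> visit_prob n 1 (0 :: int ^ 'd) ^ k"
proof (induction k)
  case (Suc k)
  have "visit_prob n (Suc k) (0 :: int ^ 'd) \<le> visit_prob n 1 (0 :: int ^ 'd) * visit_prob n k (0 :: int ^ 'd)"
    by (rule visit_prob_Suc_le)
  also have "\<dots> \<le> visit_prob n 1 (0 :: int ^ 'd) * visit_prob n 1 (0 :: int ^ 'd) ^ k"
    by (intro mult_left_mono Suc visit_prob_nonneg)
  finally show ?case by simp
qed simp

text \<open>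
  A return within the first \<open>m\<close> steps leaves at least \<open>n\<close> steps for \<open>k\<close> further returns.
\<close>

lemma visit_prob_Suc_ge:
  fixes x :: "int ^ 'd"
  shows "visit_prob m 1 x * visit_prob n k (0 :: int ^ 'd) \<le> visit_prob (m + n) (Suc k) x"
proof (induction m arbitrary: x)
  case 0
  show ?case by (simp add: visit_prob_nonneg)
next
  case (Suc m)
  have "visit_prob (Suc m) 1 x * visit_prob n k (0 :: int ^ 'd)
     = step_mean (\<lambda>e. (if x + e = 0 then 1 else visit_prob m 1 (x + e)) * visit_prob n k (0 :: int ^ 'd))"
    using visit_prob_Suc[of m 0 x] by (simp add: step_mean_mult_right cong: if_cong)
  also have "\<dots> \<le> visit_prob (Suc m + n) (Suc k) x"
    unfolding add_Suc visit_prob_Suc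
    by (rule step_mean_mono) (use Suc.IH visit_prob_mono[of n "m + n" k "0 :: int ^ 'd"] in auto)
  finally show ?case .
qed

lemma visit_prob_power_ge:
  "visit_prob m 1 (0 :: int ^ 'd) ^ k \<le> visit_prob (k * m) k (0 :: int ^ 'd)"
proof (induction k)
  case (Suc k)
  have "visit_prob m 1 (0 :: int ^ 'd) * visit_prob m 1 (0 :: int ^ 'd) ^ k \<le> visit_prob m 1 (0 :: int ^ 'd) * visit_prob (k * m) k (0 :: int ^ 'd)"
    by (intro mult_left_mono Suc visit_prob_nonneg)
  also have "\<dots> \<le> visit_prob (Suc k * m) (Suc k) (0 :: int ^ 'd)"
    using visit_prob_Suc_ge[of m "0 :: int ^ 'd" "k * m" k] by simp
  finally show ?case by simp
qed simp

lemma visit_prob_two_pos: "0 < visit_prob 2 1 (0 :: int ^ 'd)"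
proof -
  define i :: 'd where "i = undefined"
  let ?es = "[axis i 1, - axis i 1] :: (int ^ 'd) list"
  have "?es \<in> set_pmf (paths 2)"
    by (auto simp: set_replicate_pmf unit_steps_def)
  then have "0 < pmf (paths 2) ?es" by (simp add: pmf_positive_iff)
  also have "\<dots> = measure_pmf.prob (paths 2) {?es}" by (simp add: measure_pmf_single)
  also have "\<dots> \<le> visit_prob 2 1 (0 :: int ^ 'd)"
    unfolding visit_prob_def by (rule measure_pmf.finite_measure_mono) auto
  finally show ?thesis .
qed

section \<open>A superharmonic function and transience\<close>

text \<open>
  The function \<open>(a + |x|\<^sup>2) powr (-1/4)\<close> plays the part of Green's function. On \<open>\<real>\<^sup>d\<close> the Laplacian of
  \<open>(a + |x|\<^sup>2) powr (-\<beta>)\<close> is negative as soon as \<open>2 * \<beta> < d - 2\<close>, which leaves room for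
  \<open>\<beta> = 1/4\<close> in every dimension \<open>d \<ge> 3\<close>; on the lattice the room that is left absorbs the error of
  a second order expansion, provided that \<open>a\<close> is large.
\<close>

definition sqnorm :: "(int ^ 'd) \<Rightarrow> real" where
  "sqnorm x = (\<Sum>i\<in>UNIV. (real_of_int (x $ i))\<^sup>2)"

lemma sqnorm_nonneg [simp]: "0 \<le> sqnorm x"
  by (simp add: sqnorm_def sum_nonneg)

lemma sqnorm_zero [simp]: "sqnorm 0 = 0"
  by (simp add: sqnorm_def)

lemma lattice_ball_iff: "0 \<le> R \<Longrightarrow> x \<in> lattice_ball R \<longleftrightarrow> sqnorm x \<le> R\<^sup>2"
  by (simp add: lattice_ball_def norm_vec_def L2_set_def sqnorm_def real_le_lsqrt real_sqrt_le_iff'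
      sum_nonneg)

lemma sqnorm_add_axis: "sqnorm (x + axis i 1) = sqnorm x + 2 * real_of_int (x $ i) + 1"
proof -
  have "sqnorm (x + axis i 1)
      = (\<Sum>j\<in>UNIV. (real_of_int (x $ j))\<^sup>2 + (if j = i then 2 * real_of_int (x $ i) + 1 else 0))"
    unfolding sqnorm_def by (rule sum.cong) (auto simp: axis_def power2_eq_square algebra_simps)
  then show ?thesis by (simp add: sum.distrib sqnorm_def)
qed

lemma sqnorm_diff_axis: "sqnorm (x - axis i 1) = sqnorm x - 2 * real_of_int (x $ i) + 1"
  using sqnorm_add_axis[of "x - axis i 1" i] by simp

lemma step_mean_sqnorm: "step_mean (\<lambda>e. sqnorm (x + e)) = sqnorm x + 1"
  by (simp add: step_mean_def sqnorm_add_axis sqnorm_diff_axis field_simps sum_distrib_right)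

text \<open>
  The Taylor coefficient of \<open>t\<^sup>2\<close> is \<open>5/32\<close>. The larger constant \<open>9/50\<close> pays for the higher
  order terms, and it stays below \<open>3/16\<close>, the value at which the superharmonicity of the resulting
  function would be lost in dimension 3. After raising to the fourth power the claim is a polynomial
  inequality, which is obtained by squaring twice.
\<close>

lemma powr_quarter_le:
  fixes t :: real
  assumes "\<bar>t\<bar> \<le> 1/20"
  shows "(1 + t) powr (-1/4) \<le> 1 - t/4 + 9/50 * t\<^sup>2"
proof -
  define w where "w = 1 - t/4 + 9/50 * t\<^sup>2"
  define v where "v = 1 - t/2 + 41/100 * t\<^sup>2"
  have t: "-1/20 \<le> t" "t \<le> 1/20" using assms by (simp_all add: abs_le_iff)
  have t2: "0 \<le> t\<^sup>2" "t\<^sup>2 \<le> 1/400"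
    using power_mono[OF assms, of 2] by (simp_all add: power2_eq_square)
  have v0: "v > 0" and w0: "w > 0" unfolding v_def w_def using t t2 by linarith+
  have "w\<^sup>2 - v = t\<^sup>2 * (1/80 - 9/100 * t + 81/2500 * t\<^sup>2)"
    unfolding w_def v_def by (simp add: power2_eq_square algebra_simps)
  moreover have "0 \<le> t\<^sup>2 * (1/80 - 9/100 * t + 81/2500 * t\<^sup>2)"
    using t t2 by (intro mult_nonneg_nonneg) linarith+
  ultimately have "v \<le> w\<^sup>2" by linarith
  then have "v\<^sup>2 \<le> w ^ 4"
    using power_mono[of v "w\<^sup>2" 2] v0 by (simp flip: power_mult)
  have "v\<^sup>2 - (1 - t + 107/100 * t\<^sup>2 - 41/100 * t^3) = 1681/10000 * t^4"
    unfolding v_def by (simp add: power2_eq_square power3_eq_cube power4_eq_xxxx algebra_simps)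
  then have "1 - t + 107/100 * t\<^sup>2 - 41/100 * t^3 \<le> v\<^sup>2" using zero_le_power2[of "t\<^sup>2"] by (simp add: power4_eq_xxxx power2_eq_square mult.assoc)
  then have "(1 + t) * (1 - t + 107/100 * t\<^sup>2 - 41/100 * t^3) \<le> (1 + t) * w ^ 4"
    using \<open>v\<^sup>2 \<le> w ^ 4\<close> t by (intro mult_left_mono) auto
  moreover have "(1 + t) * (1 - t + 107/100 * t\<^sup>2 - 41/100 * t^3) - 1
      = t\<^sup>2 * (7/100 + 66/100 * t - 41/100 * t\<^sup>2)"
    by (simp add: power2_eq_square power3_eq_cube field_simps)
  moreover have "0 \<le> t\<^sup>2 * (7/100 + 66/100 * t - 41/100 * t\<^sup>2)"
    using t t2 by (intro mult_nonneg_nonneg) linarith+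
  ultimately have "1 \<le> (1 + t) * w ^ 4" by linarith
  then have "inverse (1 + t) \<le> w ^ 4" using t by (simp add: field_simps)
  then have "inverse (1 + t) powr (1/4) \<le> (w ^ 4) powr (1/4)"
    using t by (intro powr_mono2) auto
  also have "(w ^ 4) powr (1/4) = w"
    using w0 by (simp add: powr_powr flip: powr_numeral)
  also have "inverse (1 + t) powr (1/4) = (1 + t) powr (-1/4)"
    by (simp add: powr_minus inverse_powr flip: inverse_powr)
  finally show ?thesis by (simp add: w_def)
qed

lemma powr_quarter_add_le:
  fixes u h :: real
  assumes "u > 0" "20 * \<bar>h\<bar> \<le> u"
  shows "(u + h) powr (-1/4) \<le> u powr (-1/4) * (1 - h / (4 * u) + 9/50 * h\<^sup>2 / u\<^sup>2)"
proof -
  have "(u + h) powr (-1/4) = (u * (1 + h / u)) powr (-1/4)"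
    using assms by (simp add: distrib_left)
  also have "\<dots> = u powr (-1/4) * (1 + h / u) powr (-1/4)"
    by (rule powr_mult)
  also have "\<dots> \<le> u powr (-1/4) * (1 - (h/u)/4 + 9/50 * (h/u)\<^sup>2)"
    using assms by (intro mult_left_mono powr_quarter_le) (auto simp: field_simps)
  finally show ?thesis by (simp add: field_simps power_divide)
qed

definition potential :: "real \<Rightarrow> (int ^ 'd) \<Rightarrow> real" where
  "potential a x = (a + sqnorm x) powr (-1/4)"

text \<open>
  With \<open>u = a + |x|\<^sup>2\<close>, the squared norms of the neighbours in direction \<open>i\<close> give
  \<open>u + 1 \<plusminus> 2 x\<^sub>i\<close>. The linear terms \<open>2 x\<^sub>i\<close> cancel; the first order term contributes
  \<open>-1/(4 u)\<close> to the mean, the second order term at most \<open>(4/3) (9/50) / u = 6/(25 u)\<close>, because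
  \<open>d \<ge> 3\<close> and \<open>|x|\<^sup>2 \<le> u - 420\<close>. Together they contribute \<open>-1/(100 u)\<close>, relative to the value at \<open>x\<close>.
\<close>

lemma step_mean_potential:
  fixes x :: "int ^ 'd"
  assumes "CARD('d) \<ge> 3" "a \<ge> 420"
  shows "step_mean (\<lambda>e. potential a (x + e))
           \<le> potential a x - (a + sqnorm x) powr (-5/4) / 100"
proof -
  define u where "u = a + sqnorm x"
  define d where "d = real CARD('d)"
  have d: "d \<ge> 3" using assms by (simp add: d_def)
  have u: "u \<ge> 420" using assms(2) sqnorm_nonneg[of x] unfolding u_def by linarith
  have coord: "potential a (x + axis i 1) + potential a (x - axis i 1)
     \<le> u powr (-1/4) * (2 - 1 / (2 * u) + 9/50 * (2 + 8 * (real_of_int (x $ i))\<^sup>2) / u\<^sup>2)" for i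
  proof -
    define y where "y = real_of_int (x $ i)"
    have "y\<^sup>2 \<le> sqnorm x"
      unfolding sqnorm_def y_def by (rule member_le_sum) auto
    \<comment> \<open>The bound \<open>a \<ge> 420\<close> is what keeps the relative increments below \<open>1/20\<close>.\<close>
    moreover have "0 \<le> (\<bar>y\<bar> - 20)\<^sup>2" by simp
    then have "40 * \<bar>y\<bar> \<le> y\<^sup>2 + 400" by (simp add: power2_diff)
    ultimately have "40 * \<bar>y\<bar> \<le> sqnorm x + 400" by linarith
    then have big: "20 * (1 + 2 * \<bar>y\<bar>) \<le> u"
      using assms(2) unfolding u_def distrib_left by simp
    have tri: "\<bar>1 + 2 * y\<bar> \<le> 1 + 2 * \<bar>y\<bar>" "\<bar>1 - 2 * y\<bar> \<le> 1 + 2 * \<bar>y\<bar>" by auto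
    have small: "20 * \<bar>1 + 2 * y\<bar> \<le> u" "20 * \<bar>1 - 2 * y\<bar> \<le> u"
      using order_trans[OF mult_left_mono[OF tri(1), of 20] big]
        order_trans[OF mult_left_mono[OF tri(2), of 20] big] by auto
    let ?A = "\<lambda>h. 1 - h / (4 * u) + 9/50 * h\<^sup>2 / u\<^sup>2"
    have "potential a (x + axis i 1) = (u + (1 + 2 * y)) powr (-1/4)"
      unfolding potential_def sqnorm_add_axis u_def y_def by (simp add: algebra_simps)
    also have "\<dots> \<le> u powr (-1/4) * ?A (1 + 2 * y)"
      by (rule powr_quarter_add_le) (use u small in simp_all)
    finally have plus: "potential a (x + axis i 1) \<le> u powr (-1/4) * ?A (1 + 2 * y)" .
    have "potential a (x - axis i 1) = (u + (1 - 2 * y)) powr (-1/4)"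
      unfolding potential_def sqnorm_diff_axis u_def y_def by (simp add: algebra_simps)
    also have "\<dots> \<le> u powr (-1/4) * ?A (1 - 2 * y)"
      by (rule powr_quarter_add_le) (use u small in simp_all)
    finally have "potential a (x - axis i 1) \<le> u powr (-1/4) * ?A (1 - 2 * y)" .
    then have "potential a (x + axis i 1) + potential a (x - axis i 1)
        \<le> u powr (-1/4) * (?A (1 + 2 * y) + ?A (1 - 2 * y))"
      using plus unfolding distrib_left[of _ "?A (1 + 2 * y)"] by (rule add_mono[rotated])
    also have "?A (1 + 2 * y) + ?A (1 - 2 * y) = 2 - 1 / (2 * u) + 9/50 * (2 + 8 * y\<^sup>2) / u\<^sup>2"
      using u by (simp add: field_simps power2_eq_square)
    finally show ?thesis unfolding y_def .
  qed
  have "(\<Sum>i\<in>UNIV. potential a (x + axis i 1) + potential a (x + - axis i 1))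
     \<le> (\<Sum>i\<in>UNIV. u powr (-1/4) * (2 - 1 / (2 * u) + 9/50 * (2 + 8 * (real_of_int (x $ i))\<^sup>2) / u\<^sup>2))"
    by (rule sum_mono) (use coord in simp)
  also have "\<dots> = u powr (-1/4) * (\<Sum>i\<in>UNIV. 2 - 1 / (2 * u) + 9/25 / u\<^sup>2 + 36/25 / u\<^sup>2 * (real_of_int (x $ i))\<^sup>2)"
    unfolding sum_distrib_left by (rule sum.cong) (use u in \<open>simp_all add: field_simps\<close>)
  also have "\<dots> = u powr (-1/4) * (d * (2 - 1 / (2 * u) + 9/25 / u\<^sup>2) + 36/25 / u\<^sup>2 * sqnorm x)"
    by (simp only: sum.distrib sum_distrib_left[symmetric] sqnorm_def[symmetric])
       (simp add: d_def distrib_left)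
  also have "\<dots> \<le> u powr (-1/4) * (2 * d * (1 - 1 / (100 * u)))"
  proof (rule mult_left_mono)
    have s: "sqnorm x \<le> u - 420" using assms(2) by (simp add: u_def)
    have "d * (9/25) + 36/25 * sqnorm x \<le> d * (9/25 + 36/75 * sqnorm x)"
      using mult_right_mono[OF d, of "sqnorm x"] by (simp add: algebra_simps)
    also have "\<dots> \<le> d * (12/25 * u)"
      using d s by (intro mult_left_mono) auto
    finally have "(d * (9/25) + 36/25 * sqnorm x) / u\<^sup>2 \<le> d * (12/25 * u) / u\<^sup>2"
      by (rule divide_right_mono) simp
    also have "\<dots> = d * (12/25) / u" using u by (simp add: power2_eq_square)
    finally have *: "(d * (9/25) + 36/25 * sqnorm x) / u\<^sup>2 \<le> d * (12/25) / u" .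
    have "d * (2 - 1 / (2 * u) + 9/25 / u\<^sup>2) + 36/25 / u\<^sup>2 * sqnorm x
        = 2 * d - d / (2 * u) + (d * (9/25) + 36/25 * sqnorm x) / u\<^sup>2"
      by (simp add: algebra_simps add_divide_distrib)
    also have "\<dots> \<le> 2 * d - d / (2 * u) + d * (12/25) / u" using * by simp
    also have "\<dots> = 2 * d * (1 - 1 / (100 * u))" using u by (simp add: field_simps)
    finally show "d * (2 - 1 / (2 * u) + 9/25 / u\<^sup>2) + 36/25 / u\<^sup>2 * sqnorm x \<le> 2 * d * (1 - 1 / (100 * u))" .
  qed simp
  finally have "step_mean (\<lambda>e. potential a (x + e)) \<le> u powr (-1/4) * (1 - 1 / (100 * u))"
    using d unfolding step_mean_def d_def[symmetric] by (simp add: field_simps)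
  also have "\<dots> = u powr (-1/4) - u powr (-1/4 - 1) / 100"
    using u by (subst powr_diff) (auto simp: field_simps)
  finally show ?thesis by (simp add: potential_def u_def)
qed

lemma potential_pos: "a > 0 \<Longrightarrow> 0 < potential a x"
  using add_pos_nonneg[OF _ sqnorm_nonneg[of x], of a] by (simp add: potential_def)

lemma step_mean_potential_le:
  fixes x :: "int ^ 'd"
  assumes "CARD('d) \<ge> 3" "a \<ge> 420"
  shows "step_mean (\<lambda>e. potential a (x + e)) \<le> potential a x"
  using step_mean_potential[OF assms, of x] powr_ge_zero[of "a + sqnorm x" "-5/4"] by linarith

text \<open>
  The potential, normalised to be 1 at the origin, is superharmonic and therefore dominates
  the probability of hitting the origin.
\<close>

lemma visit_prob_le_potential:
  fixes x :: "int ^ 'd"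
  assumes "CARD('d) \<ge> 3" "a \<ge> 420"
  shows "visit_prob n 1 x \<le> step_mean (\<lambda>e. potential a (x + e)) / potential a (0 :: int ^ 'd)"
proof (induction n arbitrary: x)
  case 0
  have "0 \<le> step_mean (\<lambda>e. potential a (x + e))"
    using step_mean_mono[of "\<lambda>_. 0" "\<lambda>e. potential a (x + e)"] by (simp add: potential_def)
  then show ?case by (simp add: potential_def)
next
  case (Suc n)
  have pos: "potential a (0 :: int ^ 'd) > 0" using potential_pos[of a] assms(2) by auto
  have "visit_prob (Suc n) 1 x = step_mean (\<lambda>e. if x + e = 0 then 1 else visit_prob n 1 (x + e))"
    using visit_prob_Suc[of n 0 x] by (simp cong: if_cong)
  also have "\<dots> \<le> step_mean (\<lambda>e. potential a (x + e) * (1 / potential a (0 :: int ^ 'd)))"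
  proof (rule step_mean_mono)
    fix e
    have "visit_prob n 1 (x + e) \<le> potential a (x + e) / potential a (0 :: int ^ 'd)" 
      using Suc.IH[of "x + e"]
        divide_right_mono[OF step_mean_potential_le[OF assms, of "x + e"] less_imp_le[OF pos]]
      by (rule order_trans)
    then show "(if x + e = 0 then 1 else visit_prob n 1 (x + e)) \<le> potential a (x + e) * (1 / potential a (0 :: int ^ 'd))"
      using pos by auto
  qed
  also have "\<dots> = step_mean (\<lambda>e. potential a (x + e)) / potential a (0 :: int ^ 'd)"
    by (simp only: step_mean_mult_right) simp
  finally show ?case .
qed

text \<open>
  The potential is strictly superharmonic at the origin, so its mean over the neighbours of the
  origin is a fraction less than 1 of its value there.
\<close>

lemma transience:
  assumes "CARD('d) \<ge> 3"
  shows "\<exists>\<rho><1. \<forall>n. visit_prob n 1 (0 :: int ^ 'd) \<le> \<rho>"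
proof (intro exI conjI allI)
  let ?\<rho> = "step_mean (\<lambda>e :: int ^ 'd. potential 420 (0 + e)) / potential 420 (0 :: int ^ 'd)"
  show "visit_prob n 1 (0 :: int ^ 'd) \<le> ?\<rho>" for n
    by (rule visit_prob_le_potential) (use assms in auto)
  have "(420 + sqnorm (0 :: int ^ 'd)) powr (-5/4) > 0" by simp
  then show "?\<rho> < 1"
    using step_mean_potential[OF assms, of 420 0] potential_pos[of 420 "0 :: int ^ 'd"]
    by (simp add: divide_simps del: powr_gt_zero)
qed

section \<open>Many visits to some point of a ball are unlikely\<close>

text \<open>
  The event that some point of \<open>A\<close> is visited \<open>k + 1\<close> times, expressed through the time of the first
  of these visits instead of the point. Thus the union bound runs over times, and the \<open>k\<close> later
  visits are returns of the walk that starts afresh at that time.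
\<close>

fun heavy :: "nat \<Rightarrow> (int ^ 'd) set \<Rightarrow> (int ^ 'd) \<Rightarrow> (int ^ 'd) list \<Rightarrow> bool" where
  "heavy k A x [] \<longleftrightarrow> False"
| "heavy k A x (e # es) \<longleftrightarrow> x + e \<in> A \<and> k \<le> visits (x + e) (x + e) es \<or> heavy k A (x + e) es"

lemma heavy_if_visits: "y \<in> A \<Longrightarrow> Suc k \<le> visits y x es \<Longrightarrow> heavy k A x es"
  by (induction es arbitrary: x) (auto split: if_splits)

text \<open>
  Summing over the time of the first of the visits bounds the probability by the expected time
  spent in the ball times the probability of \<open>k\<close> returns. Inside
  the ball \<open>c\<close> times the potential with \<open>a = R\<^sup>2\<close> loses at least 1 in each step on average, hence it
  dominates the expected time in the ball. The step mean on the right-hand side accounts for the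
  visit at time 0 not being counted.
\<close>

lemma prob_heavy_le:
  fixes x :: "int ^ 'd"
  assumes dim: "CARD('d) \<ge> 3" and R: "R\<^sup>2 \<ge> 420" "R \<ge> 0"
  defines "c \<equiv> 100 * (2 * R\<^sup>2) powr (5/4)"
  shows "measure_pmf.prob (paths n) {es. heavy k (lattice_ball R) x es}
           \<le> c * step_mean (\<lambda>e. potential (R\<^sup>2) (x + e)) * visit_prob n k (0 :: int ^ 'd)"
proof (induction n arbitrary: x)
  case 0
  have "0 \<le> step_mean (\<lambda>e. potential (R\<^sup>2) (x + e))"
    using step_mean_mono[of "\<lambda>_. 0" "\<lambda>e. potential (R\<^sup>2) (x + e)"] by (simp add: potential_def)
  then show ?case by (simp add: visit_prob_nonneg c_def)
next
  case (Suc n)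
  let ?v = "\<lambda>n. visit_prob n k (0 :: int ^ 'd)"
  let ?B = "lattice_ball R :: (int ^ 'd) set"
  have Rpos: "R\<^sup>2 > 0" using R by linarith
  then have c: "c > 0" by (auto simp: c_def)
  have V: "indicator ?B y + c * step_mean (\<lambda>e. potential (R\<^sup>2) (y + e)) \<le> c * potential (R\<^sup>2) y" for y :: "int ^ 'd"
  proof (cases "y \<in> ?B")
    case True
    then have "(2 * R\<^sup>2) powr (-5/4) \<le> (R\<^sup>2 + sqnorm y) powr (-5/4)"
      using R add_pos_nonneg[OF Rpos sqnorm_nonneg[of y]]
      by (intro powr_mono2') (simp_all add: lattice_ball_iff)
    moreover have "c * (2 * R\<^sup>2) powr (-5/4) = 100"
      using Rpos by (simp add: c_def mult.assoc del: power_eq_0_iff flip: powr_add)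
    ultimately have "100 \<le> c * (R\<^sup>2 + sqnorm y) powr (-5/4)"
      using mult_left_mono[OF _ less_imp_le[OF c]] by metis
    moreover have "c * step_mean (\<lambda>e. potential (R\<^sup>2) (y + e))
        \<le> c * (potential (R\<^sup>2) y - (R\<^sup>2 + sqnorm y) powr (-5/4) / 100)"
      using c by (intro mult_left_mono step_mean_potential[OF dim R(1)]) auto
    ultimately show ?thesis using True by (simp add: algebra_simps)
  next
    case False
    then show ?thesis
      using c step_mean_potential_le[OF dim R(1), of y] by simp
  qed
  have step: "measure_pmf.prob (paths n) {es. heavy k ?B x (e # es)} \<le> c * potential (R\<^sup>2) (x + e) * ?v (Suc n)" for e
  proof -
    let ?y = "x + e"
    have "{es. heavy k ?B x (e # es)}
        \<subseteq> {es. ?y \<in> ?B \<and> k \<le> visits ?y ?y es} \<union> {es. heavy k ?B ?y es}" by auto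
    then have "measure_pmf.prob (paths n) {es. heavy k ?B x (e # es)}
        \<le> measure_pmf.prob (paths n) {es. ?y \<in> ?B \<and> k \<le> visits ?y ?y es}
          + measure_pmf.prob (paths n) {es. heavy k ?B ?y es}"
      by (intro order_trans[OF measure_pmf.finite_measure_mono measure_Un_le]) auto
    also have "measure_pmf.prob (paths n) {es. ?y \<in> ?B \<and> k \<le> visits ?y ?y es} = indicator ?B ?y * ?v n"
      using visits_translate[of 0 ?y 0] by (auto simp: visit_prob_def indicator_def)
    also have "measure_pmf.prob (paths n) {es. heavy k ?B ?y es}
        \<le> c * step_mean (\<lambda>e. potential (R\<^sup>2) (?y + e)) * ?v n" by (rule Suc.IH)
    finally have "measure_pmf.prob (paths n) {es. heavy k ?B x (e # es)}
        \<le> (indicator ?B ?y + c * step_mean (\<lambda>e. potential (R\<^sup>2) (?y + e))) * ?v n"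
      by (simp add: algebra_simps)
    also have "\<dots> \<le> c * potential (R\<^sup>2) ?y * ?v n"
      by (intro mult_right_mono V visit_prob_nonneg)
    also have "\<dots> \<le> c * potential (R\<^sup>2) ?y * ?v (Suc n)"
      using c by (intro mult_left_mono visit_prob_Suc_steps_ge) (auto simp: potential_def)
    finally show ?thesis .
  qed
  have "measure_pmf.prob (paths (Suc n)) {es. heavy k ?B x es}
      \<le> step_mean (\<lambda>e. c * potential (R\<^sup>2) (x + e) * ?v (Suc n))"
    unfolding prob_paths_Suc mem_Collect_eq by (rule step_mean_mono) (rule step)
  then show ?case
    by (simp only: step_mean_mult_left step_mean_mult_right)
qed

text \<open>
  For \<open>a = R\<^sup>2\<close>, the bound \<open>c\<close> times the potential at the origin is of order \<open>R\<^sup>2\<close>: this is the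
  diffusive time scale, and the source of the factor 2 in the limit.
\<close>

lemma prob_many_visits_le:
  assumes dim: "CARD('d) \<ge> 3" and R: "R\<^sup>2 \<ge> 420" "R \<ge> 0"
  shows "measure_pmf.prob (paths n) {es. \<exists>y\<in>lattice_ball R. Suc k \<le> visits y (0 :: int ^ 'd) es}
           \<le> 300 * R\<^sup>2 * visit_prob n 1 (0 :: int ^ 'd) ^ k"
proof -
  let ?c = "100 * (2 * R\<^sup>2) powr (5/4)"
  have "measure_pmf.prob (paths n) {es. \<exists>y\<in>lattice_ball R. Suc k \<le> visits y (0 :: int ^ 'd) es}
      \<le> measure_pmf.prob (paths n) {es. heavy k (lattice_ball R) (0 :: int ^ 'd) es}"
    by (rule measure_pmf.finite_measure_mono) (use heavy_if_visits in auto)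
  also have "\<dots> \<le> ?c * step_mean (\<lambda>e. potential (R\<^sup>2) (0 + e :: int ^ 'd)) * visit_prob n k (0 :: int ^ 'd)"
    by (rule prob_heavy_le[OF assms])
  also have "\<dots> \<le> ?c * potential (R\<^sup>2) (0 :: int ^ 'd) * visit_prob n 1 (0 :: int ^ 'd) ^ k"
    by (intro mult_mono mult_left_mono step_mean_potential_le dim R visit_prob_power_le)
       (auto simp: potential_def visit_prob_nonneg)
  also have "?c * potential (R\<^sup>2) (0 :: int ^ 'd) = 100 * 2 powr (5/4) * ((R\<^sup>2) powr (5/4) * (R\<^sup>2) powr (-1/4))"
    by (simp add: potential_def powr_mult)
  also have "(R\<^sup>2) powr (5/4) * (R\<^sup>2) powr (-1/4) = R\<^sup>2"
    using R by (simp flip: powr_add)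
  also have "100 * 2 powr (5/4) * R\<^sup>2 * visit_prob n 1 (0 :: int ^ 'd) ^ k \<le> 300 * R\<^sup>2 * visit_prob n 1 (0 :: int ^ 'd) ^ k"
  proof -
    have "(2 :: real) powr (5/4) \<le> 2 powr (3/2)" by (rule powr_mono) auto
    also have "\<dots> = 2 * sqrt 2" using powr_add[of 2 1 "1/2 :: real"] by (simp add: powr_half_sqrt)
    also have "\<dots> \<le> 3" using real_le_lsqrt[of "3/2" 2] by (simp add: power2_eq_square)
    finally show ?thesis by (intro mult_right_mono) (auto simp: visit_prob_nonneg)
  qed
  finally show ?thesis .
qed

section \<open>Some point of a ball is visited often\<close>

text \<open>
  Cut the path into \<open>N\<close> blocks of \<open>L\<close> steps. If no point is visited \<open>k\<close> times, then in no block is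
  the starting point of that block visited \<open>k\<close> times, and these events are independent.
\<close>

lemma prob_all_light_le:
  "measure_pmf.prob (paths (N * L)) {es. \<forall>y :: int ^ 'd. visits y 0 es < k}
     \<le> (1 - visit_prob L k (0 :: int ^ 'd)) ^ N"
proof (induction N)
  case (Suc N)
  let ?light = "{es. \<forall>y :: int ^ 'd. visits y 0 es < k}"
  have "measure_pmf.prob (paths (L + N * L)) ?light
     \<le> measure_pmf.prob (paths L) {es :: (int ^ 'd) list. visits 0 0 es < k} * measure_pmf.prob (paths (N * L)) ?light"
  proof (rule prob_paths_append_le, intro conjI CollectI allI)
    fix es fs :: "(int ^ 'd) list" and y
    assume *: "es @ fs \<in> ?light"
    then show "visits 0 0 es < k"
      by (auto simp: visits_append dest: spec[of _ 0])
    have "visits (y + sum_list es) 0 (es @ fs) < k" using * by blast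
    then show "visits y 0 fs < k"
      using visits_translate[of y "sum_list es" 0 fs] by (simp add: visits_append)
  qed
  also have "measure_pmf.prob (paths L) {es :: (int ^ 'd) list. visits 0 0 es < k} = 1 - visit_prob L k (0 :: int ^ 'd)"
  proof -
    have "{es :: (int ^ 'd) list. visits 0 0 es < k} = UNIV - {es. k \<le> visits 0 0 es}" by auto
    then show ?thesis
      unfolding visit_prob_def using measure_pmf.prob_compl[of "{es. k \<le> visits 0 0 es}" "paths L"] by simp
  qed
  also have "(1 - visit_prob L k (0 :: int ^ 'd)) * measure_pmf.prob (paths (N * L)) ?light
     \<le> (1 - visit_prob L k (0 :: int ^ 'd)) * (1 - visit_prob L k (0 :: int ^ 'd)) ^ N"
    by (intro mult_left_mono Suc) (simp add: visit_prob_le_1)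
  finally show ?case by simp
qed simp

fun leaves :: "'v :: monoid_add set \<Rightarrow> 'v \<Rightarrow> 'v list \<Rightarrow> bool" where
  "leaves A x [] \<longleftrightarrow> False"
| "leaves A x (e # es) \<longleftrightarrow> x + e \<notin> A \<or> leaves A (x + e) es"

lemma mem_if_visits: "\<not> leaves A x es \<Longrightarrow> 0 < visits y x es \<Longrightarrow> y \<in> A"
  by (induction es arbitrary: x) (auto split: if_splits)

text \<open>
  Kolmogorov's maximal inequality for the squared norm, whose mean grows by 1 in each step. A path
  that has just left the ball satisfies the bound trivially, since its squared norm exceeds \<open>R\<^sup>2\<close>.
\<close>

lemma prob_leaves_le:
  fixes x :: "int ^ 'd"
  assumes R: "R > 0"
  shows "measure_pmf.prob (paths n) {es. leaves (lattice_ball R) x es} \<le> (sqnorm x + real n) / R\<^sup>2"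
proof (induction n arbitrary: x)
  case (Suc n)
  let ?B = "lattice_ball R :: (int ^ 'd) set"
  have "measure_pmf.prob (paths n) {es. leaves ?B x (e # es)} \<le> (sqnorm (x + e) + real n) * (1 / R\<^sup>2)" for e
  proof (cases "x + e \<in> ?B")
    case True
    then show ?thesis using Suc[of "x + e"] by simp
  next
    case False
    then have "1 \<le> (sqnorm (x + e) + real n) / R\<^sup>2"
      using R by (simp add: lattice_ball_iff)
    then show ?thesis by (simp add: order_trans[OF measure_pmf.prob_le_1])
  qed
  then have "measure_pmf.prob (paths (Suc n)) {es. leaves ?B x es}
       \<le> step_mean (\<lambda>e. (sqnorm (x + e) + real n) * (1 / R\<^sup>2))"
    unfolding prob_paths_Suc mem_Collect_eq by (rule step_mean_mono)
  also have "\<dots> = step_mean (\<lambda>e. sqnorm (x + e) + real n) / R\<^sup>2"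
    by (simp only: step_mean_mult_right) simp
  also have "step_mean (\<lambda>e. sqnorm (x + e) + real n) = step_mean (\<lambda>e. sqnorm (x + e)) + real n"
    by (simp add: step_mean_def sum.distrib field_simps)
  also have "\<dots> = sqnorm x + real (Suc n)" by (simp add: step_mean_sqnorm)
  finally show ?case .
qed simp

text \<open>
  A point that is visited at least once lies in the ball unless the path has left the ball. Within
  a block of \<open>k * m\<close> steps, \<open>k\<close> successive returns of at most \<open>m\<close> steps each have probability at
  least the \<open>k\<close>-th power of the probability of a return within \<open>m\<close> steps.
\<close>

lemma prob_no_heavy_point_le:
  assumes R: "R > 0" and k: "k > 0"
  shows "measure_pmf.prob (paths (N * (k * m))) {es. \<forall>y\<in>lattice_ball R. visits y (0 :: int ^ 'd) es < k}
     \<le> exp (- real N * visit_prob m 1 (0 :: int ^ 'd) ^ k) + real (N * (k * m)) / R\<^sup>2"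
proof -
  let ?n = "N * (k * m)" and ?q = "visit_prob m 1 (0 :: int ^ 'd)"
  have "measure_pmf.prob (paths ?n) {es. \<forall>y\<in>lattice_ball R. visits y (0 :: int ^ 'd) es < k}
     \<le> measure_pmf.prob (paths ?n) ({es. \<forall>y :: int ^ 'd. visits y 0 es < k} \<union> {es. leaves (lattice_ball R) 0 es})"
    using k by (intro measure_pmf.finite_measure_mono) (auto simp: not_less dest: mem_if_visits[of _ 0], use mem_if_visits in force)
  also have "\<dots> \<le> measure_pmf.prob (paths ?n) {es. \<forall>y :: int ^ 'd. visits y 0 es < k}
      + measure_pmf.prob (paths ?n) {es. leaves (lattice_ball R) (0 :: int ^ 'd) es}"
    by (rule measure_Un_le) auto
  also have "measure_pmf.prob (paths ?n) {es. leaves (lattice_ball R) (0 :: int ^ 'd) es} \<le> real ?n / R\<^sup>2"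
    using prob_leaves_le[OF R, of ?n "0 :: int ^ 'd"] by simp
  also have "measure_pmf.prob (paths ?n) {es. \<forall>y :: int ^ 'd. visits y 0 es < k}
      \<le> (1 - visit_prob (k * m) k (0 :: int ^ 'd)) ^ N"
    by (rule prob_all_light_le)
  also have "\<dots> \<le> exp (- (?q ^ k)) ^ N"
  proof (rule power_mono)
    have "1 - visit_prob (k * m) k (0 :: int ^ 'd) \<le> 1 - ?q ^ k"
      using visit_prob_power_ge[of m k, where 'd = 'd] by simp
    also have "\<dots> \<le> exp (- (?q ^ k))" using exp_ge_add_one_self[of "- (?q ^ k)"] by simp
    finally show "1 - visit_prob (k * m) k (0 :: int ^ 'd) \<le> exp (- (?q ^ k))" .
  qed (simp add: visit_prob_le_1)
  also have "exp (- (?q ^ k)) ^ N = exp (- real N * ?q ^ k)"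
    by (simp flip: exp_of_nat_mult)
  finally show ?thesis by simp
qed

section \<open>The law of the steps and the return probability\<close>

definition step_list :: "(nat \<Rightarrow> 'a \<Rightarrow> 'v) \<Rightarrow> nat \<Rightarrow> 'a \<Rightarrow> 'v list" where
  "step_list X n \<omega> = map (\<lambda>k. X k \<omega>) [1..<Suc n]"

lemma step_list_Suc: "step_list X (Suc n) \<omega> = step_list X n \<omega> @ [X (Suc n) \<omega>]"
  by (simp add: step_list_def)

lemma length_step_list [simp]: "length (step_list X n \<omega>) = n"
  by (simp add: step_list_def)

lemma step_list_eq_iff:
  "step_list X n \<omega> = es \<longleftrightarrow> length es = n \<and> (\<forall>k\<in>{1..n}. X k \<omega> = es ! (k - 1))"
proof -
  have "step_list X n \<omega> = es \<longleftrightarrow> length es = n \<and> (\<forall>i<n. X (Suc i) \<omega> = es ! i)"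
    unfolding step_list_def list_eq_iff_nth_eq by (auto simp: nth_append simp del: upt_Suc)
  also have "(\<forall>i<n. X (Suc i) \<omega> = es ! i) \<longleftrightarrow> (\<forall>k\<in>{1..n}. X k \<omega> = es ! (k - 1))"
    by (metis (no_types, lifting) One_nat_def Suc_le_eq atLeastAtMost_iff diff_Suc_1 le_add1 plus_1_eq_Suc Suc_pred)
  finally show ?thesis .
qed

lemma sum_list_step_list: "sum_list (step_list X n \<omega>) = walk X n \<omega>"
  by (induction n) (simp_all add: step_list_Suc walk_def, simp add: step_list_def)

lemma local_time_eq_visits: "local_time X y n \<omega> = visits y 0 (step_list X n \<omega>)"
proof (induction n)
  case (Suc n)
  have "{k. 0 < k \<and> k \<le> Suc n \<and> walk X k \<omega> = y}
      = {k. 0 < k \<and> k \<le> n \<and> walk X k \<omega> = y} \<union> (if walk X (Suc n) \<omega> = y then {Suc n} else {})"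
    by (auto simp: le_Suc_eq)
  then have "local_time X y (Suc n) \<omega> = local_time X y n \<omega> + (if walk X (Suc n) \<omega> = y then 1 else 0)"
    unfolding local_time_def by auto
  moreover have "walk X n \<omega> + X (Suc n) \<omega> = walk X (Suc n) \<omega>" by (simp add: walk_def)
  ultimately show ?case
    by (simp add: step_list_Suc visits_append sum_list_step_list Suc)
qed (auto simp: local_time_def step_list_def)

lemma local_time_mono: "m \<le> n \<Longrightarrow> local_time X y m \<omega> \<le> local_time X y n \<omega>"
  unfolding local_time_def by (rule card_mono) auto

lemma pmf_replicate_pmf:
  "pmf (replicate_pmf n p) es = (if length es = n then \<Prod>k\<in>{1..n}. pmf p (es ! (k - 1)) else 0)"
proof (induction n arbitrary: es)
  case 0
  then show ?case by simp
next
  case (Suc n)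
  have eq: "replicate_pmf (Suc n) p = map_pmf (\<lambda>(x, xs). x # xs) (pair_pmf p (replicate_pmf n p))"
    by (simp add: pair_pmf_def map_bind_pmf)
  have inj: "inj (\<lambda>(x, xs). x # xs :: 'a list)" by (auto simp: inj_on_def)
  show ?case
  proof (cases es)
    case Nil
    then show ?thesis by (simp add: pmf_eq_0_set_pmf set_replicate_pmf del: replicate_pmf.simps)
  next
    case (Cons e fs)
    have "pmf (replicate_pmf (Suc n) p) es = pmf p e * pmf (replicate_pmf n p) fs"
      unfolding eq Cons using pmf_map_inj'[OF inj, of _ "(e, fs)"] by (simp add: pmf_pair)
    moreover have "(\<Prod>k\<in>{1..Suc n}. pmf p (es ! (k - 1))) = pmf p e * (\<Prod>k\<in>{1..n}. pmf p (fs ! (k - 1)))"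
      unfolding One_nat_def prod.atLeast1_atMost_eq prod.lessThan_Suc_shift by (simp add: Cons)
    ultimately show ?thesis using Cons Suc by simp
  qed
qed

context simple_random_walk
begin

lemma random_variable_step: "k \<ge> 1 \<Longrightarrow> X k \<in> measurable M (count_space UNIV)"
  using indep_steps unfolding indep_vars_def by auto

lemma step_event: "k \<ge> 1 \<Longrightarrow> {\<omega> \<in> space M. X k \<omega> = e} \<in> events"
  using measurable_sets[OF random_variable_step, of k "{e}"] by (simp add: vimage_def Int_def conj_commute)

text \<open>
  The prescribed values on the \<open>2 d\<close> unit steps already add up to 1, so no mass is left for any
  other vector.
\<close>

lemma prob_step:
  assumes k: "k \<ge> 1"
  shows "prob {\<omega> \<in> space M. X k \<omega> = e} = pmf (pmf_of_set unit_steps) e"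
proof -
  let ?P = "\<lambda>e. prob {\<omega> \<in> space M. X k \<omega> = e}"
  have unit: "?P e = 1 / real (card (unit_steps :: (int ^ 'd) set))" if "e \<in> unit_steps" for e
    using that prob_step_plus[OF k] prob_step_minus[OF k] card_unit_steps[where 'd = 'd]
    by (auto simp: unit_steps_def)
  show ?thesis
  proof (cases "e \<in> unit_steps")
    case True
    then show ?thesis using unit by simp
  next
    case False
    have "?P e + 1 = ?P e + (\<Sum>e\<in>unit_steps. ?P e)"
      using unit by simp
    also have "\<dots> = (\<Sum>e\<in>insert e unit_steps. ?P e)" using False by simp
    also have "\<dots> = prob (\<Union>e\<in>insert e unit_steps. {\<omega> \<in> space M. X k \<omega> = e})"
      using step_event[OF k] by (intro finite_measure_finite_Union[symmetric]) (auto simp: disjoint_family_on_def)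
    also have "\<dots> \<le> 1" by (rule prob_le_1)
    finally have "?P e = 0" using measure_nonneg[of M] by (metis add_le_same_cancel2 antisym)
    then show ?thesis using False by simp
  qed
qed

lemma step_list_singleton:
  assumes "length es = n"
  shows "{\<omega> \<in> space M. step_list X n \<omega> = es} \<in> events"
    and "prob {\<omega> \<in> space M. step_list X n \<omega> = es} = pmf (paths n) es"
proof -
  have eq: "{\<omega> \<in> space M. step_list X n \<omega> = es} = {\<omega> \<in> space M. \<forall>k\<in>{1..n}. X k \<omega> = es ! (k - 1)}"
    using assms by (auto simp: step_list_eq_iff)
  show "{\<omega> \<in> space M. step_list X n \<omega> = es} \<in> events"
    unfolding eq using step_event by (intro sets.sets_Collect_finite_All) auto
  show "prob {\<omega> \<in> space M. step_list X n \<omega> = es} = pmf (paths n) es"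
  proof (cases "n = 0")
    case False
    have "{\<omega> \<in> space M. step_list X n \<omega> = es} = (\<Inter>k\<in>{1..n}. X k -` {es ! (k - 1)} \<inter> space M)"
      unfolding eq using False by auto
    then have "prob {\<omega> \<in> space M. step_list X n \<omega> = es} = (\<Prod>k\<in>{1..n}. prob (X k -` {es ! (k - 1)} \<inter> space M))"
      using False by (simp only:) (rule indep_varsD[OF indep_steps], auto)
    also have "\<dots> = (\<Prod>k\<in>{1..n}. pmf (pmf_of_set unit_steps) (es ! (k - 1)))"
      by (rule prod.cong) (auto simp: vimage_def Int_def conj_commute prob_step)
    finally show ?thesis using assms by (simp add: pmf_replicate_pmf)
  qed (use assms in \<open>simp add: step_list_def prob_space\<close>)
qed

lemma measurable_step_list: "step_list X n \<in> measurable M (count_space UNIV)"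
  unfolding measurable_count_space_eq2_countable
proof (intro conjI ballI)
  fix es :: "(int ^ 'd) list"
  show "step_list X n -` {es} \<inter> space M \<in> events"
  proof (cases "length es = n")
    case True
    then show ?thesis using step_list_singleton(1)[of es n] by (simp add: vimage_def Int_def conj_commute)
  next
    case False
    then have "step_list X n -` {es} \<inter> space M = {}" by auto
    then show ?thesis by simp
  qed
qed auto

text \<open>
  This transfers the estimates for finite paths to the probability space of the walk.
\<close>

lemma distr_step_list: "distr M (count_space UNIV) (step_list X n) = measure_pmf (paths n)"
proof (rule measure_eqI_countable[of _ UNIV])
  fix es :: "(int ^ 'd) list"
  have "emeasure (distr M (count_space UNIV) (step_list X n)) {es} = prob {\<omega> \<in> space M. step_list X n \<omega> = es}"
    using measurable_step_list by (simp add: emeasure_distr emeasure_eq_measure vimage_def Int_def conj_commute)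
  also have "prob {\<omega> \<in> space M. step_list X n \<omega> = es} = pmf (paths n) es"
  proof (cases "length es = n")
    case False
    then have "{\<omega> \<in> space M. step_list X n \<omega> = es} = {}" by auto
    then show ?thesis using False by (simp only: measure_empty pmf_replicate_pmf if_False)
  qed (rule step_list_singleton)
  finally show "emeasure (distr M (count_space UNIV) (step_list X n)) {es} = emeasure (paths n) {es}"
    by (simp add: emeasure_pmf_single)
qed auto

lemma step_list_event: "{\<omega> \<in> space M. P (step_list X n \<omega>)} \<in> events"
  using measurable_sets[OF measurable_step_list, of "Collect P" n] by (simp add: vimage_def Int_def conj_commute)

lemma prob_step_list: "prob {\<omega> \<in> space M. P (step_list X n \<omega>)} = measure_pmf.prob (paths n) (Collect P)"
proof -
  have "measure_pmf.prob (paths n) (Collect P) = measure (distr M (count_space UNIV) (step_list X n)) (Collect P)"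
    by (simp add: distr_step_list)
  also have "\<dots> = prob {\<omega> \<in> space M. P (step_list X n \<omega>)}"
    using measurable_step_list by (simp add: measure_distr vimage_def Int_def conj_commute)
  finally show ?thesis ..
qed

definition return_prob :: real where
  "return_prob = 1 - escape_prob M X"

text \<open>
  The walk escapes if and only if its local time at the origin vanishes for every \<open>n\<close>; apply
  continuity from above.
\<close>

lemma visit_prob_tendsto: "(\<lambda>n. visit_prob n 1 (0 :: int ^ 'd)) \<longlonglongrightarrow> return_prob"
proof -
  let ?A = "\<lambda>n. {\<omega> \<in> space M. local_time X 0 n \<omega> = 0}"
  have A: "?A n \<in> events" and "prob (?A n) = 1 - visit_prob n 1 (0 :: int ^ 'd)" for n
  proof -
    show "?A n \<in> events" unfolding local_time_eq_visits by (rule step_list_event)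
    have "prob (?A n) = measure_pmf.prob (paths n) {es :: (int ^ 'd) list. visits 0 0 es = 0}"
      unfolding local_time_eq_visits by (rule prob_step_list)
    also have "{es :: (int ^ 'd) list. visits 0 0 es = 0} = UNIV - {es. 1 \<le> visits 0 0 es}" by auto
    finally show "prob (?A n) = 1 - visit_prob n 1 (0 :: int ^ 'd)"
      unfolding visit_prob_def using measure_pmf.prob_compl[of "{es. 1 \<le> visits 0 0 es}" "paths n"] by simp
  qed
  moreover have "(\<lambda>n. prob (?A n)) \<longlonglongrightarrow> prob (\<Inter>n. ?A n)"
  proof (rule finite_Lim_measure_decseq)
    show "decseq ?A"
      unfolding decseq_def
    proof (intro allI impI subsetI)
      fix m n \<omega> assume "m \<le> n" "\<omega> \<in> ?A n"
      then show "\<omega> \<in> ?A m" using local_time_mono[of m n X 0 \<omega>] by simp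
    qed
  qed (use A in auto)
  moreover have "(\<Inter>n. ?A n) = {\<omega> \<in> space M. \<forall>k\<ge>1. walk X k \<omega> \<noteq> 0}"
  proof -
    have "local_time X 0 n \<omega> = 0 \<longleftrightarrow> (\<forall>k. 1 \<le> k \<and> k \<le> n \<longrightarrow> walk X k \<omega> \<noteq> 0)" for n \<omega>
      by (auto simp: local_time_def Suc_le_eq)
    then show ?thesis by auto
  qed
  ultimately have "(\<lambda>n. 1 - visit_prob n 1 (0 :: int ^ 'd)) \<longlonglongrightarrow> escape_prob M X"
    by (simp add: escape_prob_def)
  from tendsto_diff[OF tendsto_const[of 1] this] show ?thesis by (simp add: return_prob_def)
qed

lemma visit_prob_le_return_prob: "visit_prob n 1 (0 :: int ^ 'd) \<le> return_prob"
  by (rule incseq_le[OF _ visit_prob_tendsto]) (simp add: incseq_def visit_prob_mono)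

lemma return_prob_pos: "0 < return_prob"
  using visit_prob_two_pos[where 'd = 'd] visit_prob_le_return_prob[of 2] by linarith

lemma return_prob_less_1:
  assumes "CARD('d) \<ge> 3"
  shows "return_prob < 1"
proof -
  obtain \<rho> where "\<rho> < 1" "\<And>n. visit_prob n 1 (0 :: int ^ 'd) \<le> \<rho>"
    using transience[OF assms] by blast
  then show ?thesis
    using LIMSEQ_le_const2[OF visit_prob_tendsto, of \<rho>] by force
qed

end

section \<open>Almost sure bounds along dyadic radii\<close>

lemma power_two_eq_exp: "(2 :: real) ^ j = exp (real j * ln 2)"
  by (simp add: exp_of_nat_mult)

context simple_random_walk
begin

lemma ln_return_prob:
  assumes "CARD('d) \<ge> 3"
  shows "ln return_prob = - (1 / walk_lambda M X)" and "walk_lambda M X > 0"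
proof -
  have l: "walk_lambda M X = - (1 / ln return_prob)"
    by (simp add: walk_lambda_def return_prob_def)
  have "ln return_prob < 0"
    using return_prob_pos return_prob_less_1[OF assms] by (simp add: ln_less_zero)
  then show "ln return_prob = - (1 / walk_lambda M X)" and "walk_lambda M X > 0"
    unfolding l by (simp_all add: divide_simps)
qed

text \<open>
  With \<open>R = 2 ^ j\<close>, \<open>q\<close> the return probability and \<open>k = (2 + \<epsilon>) \<lambda> log R\<close>, the bound \<open>C R\<^sup>2 q ^ k\<close> becomes
  \<open>C R powr (-\<epsilon>)\<close>, which is summable over \<open>j\<close>. The bound holds for all times at once, because the
  finite-time bounds are uniform in \<open>n\<close>.
\<close>

lemma AE_local_time_le:
  assumes dim: "CARD('d) \<ge> 3" and \<epsilon>: "\<epsilon> > 0"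
  shows "AE \<omega> in M. \<forall>\<^sub>F j in sequentially. \<forall>n. \<forall>y\<in>lattice_ball (2 ^ j).
           real (local_time X y n \<omega>) \<le> (2 + \<epsilon>) * walk_lambda M X * (real j * ln 2) + 1"
proof -
  define \<Lambda> where "\<Lambda> = walk_lambda M X"
  have \<Lambda>: "\<Lambda> > 0" "ln return_prob = - (1 / \<Lambda>)"
    using ln_return_prob[OF dim] by (simp_all add: \<Lambda>_def)
  define k where "k j = nat \<lceil>(2 + \<epsilon>) * \<Lambda> * (real j * ln 2)\<rceil>" for j
  have k_ge: "(2 + \<epsilon>) * \<Lambda> * (real j * ln 2) \<le> real (k j)" for j
    unfolding k_def by linarith
  have k_le: "real (k j) \<le> (2 + \<epsilon>) * \<Lambda> * (real j * ln 2) + 1" for j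
  proof -
    have "0 \<le> (2 + \<epsilon>) * \<Lambda> * (real j * ln 2)" using \<Lambda> \<epsilon> by simp
    then show ?thesis unfolding k_def by linarith
  qed
  define A where "A j n = {\<omega> \<in> space M. \<exists>y\<in>lattice_ball (2 ^ j). Suc (k j) \<le> local_time X y n \<omega>}" for j n
  define U where "U j = (\<Union>n. A j n)" for j
  have A: "A j n \<in> events" for j n
    unfolding A_def local_time_eq_visits by (rule step_list_event)
  have prob_A: "prob (A j n) \<le> 300 * exp (- \<epsilon> * ln 2) ^ j" if j: "j \<ge> 5" for j n
  proof -
    \<comment> \<open>The estimate for the ball needs \<open>R\<^sup>2 \<ge> 420\<close>, and \<open>2 ^ 10 = 1024\<close>.\<close>
    have "(2 :: real) ^ 5 \<le> 2 ^ j" using j by (intro power_increasing) auto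
    then have "(2 ^ 5)\<^sup>2 \<le> ((2 :: real) ^ j)\<^sup>2" by (intro power_mono) auto
    then have R: "420 \<le> ((2 :: real) ^ j)\<^sup>2" by simp
    have "prob (A j n) = measure_pmf.prob (paths n)
        {es :: (int ^ 'd) list. \<exists>y\<in>lattice_ball (2 ^ j). Suc (k j) \<le> visits y 0 es}"
      unfolding A_def local_time_eq_visits by (rule prob_step_list)
    also have "\<dots> \<le> 300 * (2 ^ j)\<^sup>2 * visit_prob n 1 (0 :: int ^ 'd) ^ k j"
      by (rule prob_many_visits_le[OF dim R]) simp
    also have "\<dots> \<le> 300 * (2 ^ j)\<^sup>2 * return_prob ^ k j"
      by (intro mult_left_mono power_mono visit_prob_le_return_prob visit_prob_nonneg) auto
    also have "return_prob ^ k j = exp (ln return_prob) ^ k j"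
      using return_prob_pos by simp
    also have "\<dots> = exp (- (real (k j) / \<Lambda>))"
      unfolding \<Lambda>(2) by (simp flip: exp_of_nat_mult)
    also have "\<dots> \<le> exp (- ((2 + \<epsilon>) * (real j * ln 2)))"
      using k_ge[of j] \<Lambda>(1) by (simp add: field_simps)
    also have "(2 ^ j)\<^sup>2 = exp (2 * (real j * ln 2))"
      by (simp only: power_two_eq_exp exp_double)
    also have "300 * exp (2 * (real j * ln 2)) * exp (- ((2 + \<epsilon>) * (real j * ln 2))) = 300 * exp (- \<epsilon> * ln 2) ^ j"
      by (simp add: algebra_simps flip: exp_add exp_of_nat_mult)
    finally show ?thesis by simp
  qed
  have prob_U: "prob (U j) \<le> 300 * exp (- \<epsilon> * ln 2) ^ j" if j: "j \<ge> 5" for j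
  proof -
    have "incseq (A j)"
      unfolding incseq_def
    proof (intro allI impI subsetI)
      fix m n \<omega> assume mn: "m \<le> n" and "\<omega> \<in> A j m"
      then obtain y where y: "\<omega> \<in> space M" "y \<in> lattice_ball (2 ^ j)" "Suc (k j) \<le> local_time X y m \<omega>"
        by (auto simp: A_def)
      then have "Suc (k j) \<le> local_time X y n \<omega>" using local_time_mono[OF mn, of X y \<omega>] by linarith
      with y show "\<omega> \<in> A j n" unfolding A_def by blast
    qed
    then have "(\<lambda>n. prob (A j n)) \<longlonglongrightarrow> prob (U j)"
      unfolding U_def using A by (intro finite_Lim_measure_incseq) auto
    then show ?thesis
      by (rule LIMSEQ_le_const2) (use prob_A[OF j] in blast)
  qed
  have "AE \<omega> in M. \<forall>\<^sub>F j in sequentially. \<omega> \<in> space M - U j"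
  proof (rule borel_cantelli_AE1)
    show "U j \<in> events" for j unfolding U_def using A by auto
    show "summable (\<lambda>j. prob (U j))"
    proof (rule summable_comparison_test_ev)
      show "\<forall>\<^sub>F j in sequentially. norm (prob (U j)) \<le> 300 * exp (- \<epsilon> * ln 2) ^ j"
        using eventually_ge_at_top[of 5] by eventually_elim (use prob_U in simp)
      show "summable (\<lambda>j. 300 * exp (- \<epsilon> * ln 2) ^ j)"
        using \<epsilon> by (intro summable_mult summable_geometric) simp
    qed
  qed (simp add: emeasure_eq_measure)
  then show ?thesis
  proof eventually_elim
    case (elim \<omega>)
    then show ?case
    proof eventually_elim
      case (elim j)
      then have "local_time X y n \<omega> \<le> k j" if "y \<in> lattice_ball (2 ^ j)" for y n
        using that by (auto simp: U_def A_def not_less_eq_eq)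
      then show ?case
        using k_le[of j] unfolding \<Lambda>_def[symmetric] by (meson of_nat_le_iff order_trans)
    qed
  qed
qed

text \<open>
  Again let \<open>R = 2 ^ j\<close> and let \<open>q\<close> be the return probability. Fix \<open>m\<close> such that a return within \<open>m\<close>
  steps has probability at least \<open>q powr (1 + \<delta>)\<close>. For \<open>k = (2 - 4 \<delta>) \<lambda> log R\<close> a block of \<open>k * m\<close>
  steps succeeds with probability at least \<open>R powr (-(1 + \<delta>) (2 - 4 \<delta>)) \<ge> R powr (-(2 - 2 \<delta>))\<close>, so
  \<open>N = R powr (2 - \<delta>)\<close> blocks all fail with probability at most
  \<open>exp (-(R powr \<delta>)) \<le> R powr (-\<delta>)\<close>. They take
  \<open>T = N * k * m\<close> steps; the logarithmic factor \<open>k\<close> is absorbed by passing to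
  \<open>R powr (2 - \<delta>/2)\<close>, so the walk leaves the ball before time \<open>T\<close> with probability at most
  \<open>R powr (-\<delta>/2)\<close>.
\<close>

lemma AE_local_time_ge:
  assumes dim: "CARD('d) \<ge> 3" and \<delta>: "0 < \<delta>" "\<delta> < 1/2"
  shows "AE \<omega> in M. \<forall>\<^sub>F j in sequentially. \<forall>n. exp ((2 - \<delta> / 2) * (real j * ln 2)) \<le> real n \<longrightarrow>
           (\<exists>y\<in>lattice_ball (2 ^ j). (2 - 4 * \<delta>) * walk_lambda M X * (real j * ln 2) - 1 \<le> real (local_time X y n \<omega>))"
proof -
  define \<Lambda> where "\<Lambda> = walk_lambda M X"
  have \<Lambda>: "\<Lambda> > 0" "ln return_prob = - (1 / \<Lambda>)"
    using ln_return_prob[OF dim] by (simp_all add: \<Lambda>_def)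
  define q where "q m = visit_prob m 1 (0 :: int ^ 'd)" for m
  have "(1 + \<delta>) * ln return_prob < ln return_prob"
    using \<Lambda> \<delta> by (simp add: divide_strict_right_mono)
  then have "exp ((1 + \<delta>) * ln return_prob) < return_prob"
    using return_prob_pos by (metis exp_less_mono exp_ln)
  then have "\<forall>\<^sub>F m in sequentially. exp ((1 + \<delta>) * ln return_prob) < q m"
    unfolding q_def by (rule order_tendstoD(1)[OF visit_prob_tendsto])
  then obtain m where m: "exp ((1 + \<delta>) * ln return_prob) < q m"
    using eventually_happens by fastforce
  define k where "k j = nat \<lfloor>(2 - 4 * \<delta>) * \<Lambda> * (real j * ln 2)\<rfloor>" for j
  define N where "N j = nat \<lceil>exp ((2 - \<delta>) * (real j * ln 2))\<rceil>" for j
  define T where "T j = N j * (k j * m)" for j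
  have k_le: "real (k j) \<le> (2 - 4 * \<delta>) * \<Lambda> * (real j * ln 2)" for j
  proof -
    have "0 \<le> (2 - 4 * \<delta>) * \<Lambda> * (real j * ln 2)" using \<Lambda> \<delta> by simp
    then show ?thesis unfolding k_def by linarith
  qed
  have k_ge: "(2 - 4 * \<delta>) * \<Lambda> * (real j * ln 2) - 1 \<le> real (k j)" for j
    unfolding k_def by linarith
  have N_ge: "exp ((2 - \<delta>) * (real j * ln 2)) \<le> real (N j)" for j
    unfolding N_def by linarith
  have N_le: "real (N j) \<le> 2 * exp ((2 - \<delta>) * (real j * ln 2))" for j
  proof -
    have "1 \<le> exp ((2 - \<delta>) * (real j * ln 2))" using \<delta> by simp
    then show ?thesis unfolding N_def by linarith
  qed
  have k_pos: "\<forall>\<^sub>F j in sequentially. k j > 0"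
  proof -
    have "filterlim (\<lambda>j. (2 - 4 * \<delta>) * \<Lambda> * ln 2 * real j) at_top sequentially"
      using \<Lambda> \<delta> by (intro filterlim_tendsto_pos_mult_at_top[OF tendsto_const] filterlim_real_sequentially) auto
    then have "\<forall>\<^sub>F j in sequentially. 1 < (2 - 4 * \<delta>) * \<Lambda> * ln 2 * real j"
      by (rule filterlim_at_top_dense[THEN iffD1, rule_format])
    then show ?thesis
    proof eventually_elim
      case (elim j)
      then have "1 < (2 - 4 * \<delta>) * \<Lambda> * (real j * ln 2)" by (simp add: mult_ac)
      with k_ge[of j] show ?case by linarith
    qed
  qed
  have T_le: "\<forall>\<^sub>F j in sequentially. real (T j) \<le> exp ((2 - \<delta> / 2) * (real j * ln 2))"
  proof -
    define C where "C = 2 * ((2 - 4 * \<delta>) * \<Lambda> * ln 2 * real m)"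
    have "(\<lambda>j. C * (real j * exp (- (\<delta> / 2 * ln 2)) ^ j)) \<longlonglongrightarrow> C * 0"
      using \<delta> by (intro tendsto_mult_left powser_times_n_limit_0) simp
    then have "\<forall>\<^sub>F j in sequentially. C * (real j * exp (- (\<delta> / 2 * ln 2)) ^ j) < 1"
      by (rule order_tendstoD) simp
    then show ?thesis
    proof eventually_elim
      case (elim j)
      have "real (T j) = real (N j) * (real (k j) * real m)" by (simp add: T_def)
      also have "\<dots> \<le> (2 * exp ((2 - \<delta>) * (real j * ln 2))) * (((2 - 4 * \<delta>) * \<Lambda> * (real j * ln 2)) * real m)"
        using N_le k_le by (intro mult_mono mult_right_mono) auto
      also have "\<dots> = exp ((2 - \<delta> / 2) * (real j * ln 2)) * (C * (real j * exp (- (\<delta> / 2 * ln 2)) ^ j))"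
      proof -
        have "exp ((2 - \<delta>) * (real j * ln 2)) = exp ((2 - \<delta> / 2) * (real j * ln 2)) * exp (- (\<delta> / 2 * ln 2)) ^ j"
          by (simp add: algebra_simps flip: exp_add exp_of_nat_mult)
        then show ?thesis by (simp add: C_def)
      qed
      also have "\<dots> \<le> exp ((2 - \<delta> / 2) * (real j * ln 2)) * 1"
        using elim by (intro mult_left_mono) auto
      finally show ?case by simp
    qed
  qed
  define F where "F j = {\<omega> \<in> space M. \<forall>y\<in>lattice_ball (2 ^ j). local_time X y (T j) \<omega> < k j}" for j
  have F: "F j \<in> events" for j
    unfolding F_def local_time_eq_visits by (rule step_list_event)
  have prob_F: "\<forall>\<^sub>F j in sequentially. prob (F j) \<le> exp (- \<delta> * ln 2) ^ j + exp (- (\<delta> / 2) * ln 2) ^ j"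
    using k_pos T_le
  proof eventually_elim
    case (elim j)
    have "prob (F j) = measure_pmf.prob (paths (T j))
        {es :: (int ^ 'd) list. \<forall>y\<in>lattice_ball (2 ^ j). visits y 0 es < k j}"
      unfolding F_def local_time_eq_visits by (rule prob_step_list)
    also have "\<dots> \<le> exp (- real (N j) * q m ^ k j) + real (T j) / (2 ^ j)\<^sup>2"
      unfolding T_def q_def by (rule prob_no_heavy_point_le) (use elim in auto)
    also have "exp (- real (N j) * q m ^ k j) \<le> exp (- \<delta> * ln 2) ^ j"
    proof -
      have "- ((2 - 2 * \<delta>) * (real j * ln 2)) \<le> - ((1 + \<delta>) * (2 - 4 * \<delta>) * (real j * ln 2))"
        using \<delta> by (simp add: algebra_simps)
      also have "\<dots> \<le> - ((1 + \<delta>) * (real (k j) / \<Lambda>))"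
      proof -
        have "real (k j) / \<Lambda> \<le> (2 - 4 * \<delta>) * (real j * ln 2)"
          using k_le[of j] \<Lambda>(1) by (simp add: divide_le_eq mult_ac)
        then have "(1 + \<delta>) * (real (k j) / \<Lambda>) \<le> (1 + \<delta>) * ((2 - 4 * \<delta>) * (real j * ln 2))"
          using \<delta> by (intro mult_left_mono) auto
        then show ?thesis by (simp add: mult.assoc)
      qed
      also have "\<dots> = real (k j) * ((1 + \<delta>) * ln return_prob)"
        unfolding \<Lambda>(2) by simp
      finally have "exp (- ((2 - 2 * \<delta>) * (real j * ln 2))) \<le> exp ((1 + \<delta>) * ln return_prob) ^ k j"
        by (simp flip: exp_of_nat_mult)
      also have "\<dots> \<le> q m ^ k j" using m by (intro power_mono) auto
      finally have "exp ((2 - \<delta>) * (real j * ln 2)) * exp (- ((2 - 2 * \<delta>) * (real j * ln 2))) \<le> real (N j) * q m ^ k j"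
        using N_ge by (intro mult_mono) auto
      then have "exp (\<delta> * ln 2 * real j) \<le> real (N j) * q m ^ k j"
        by (simp add: algebra_simps flip: exp_add)
      then have "\<delta> * ln 2 * real j \<le> real (N j) * q m ^ k j"
        using exp_ge_add_one_self[of "\<delta> * ln 2 * real j"] by linarith
      then show ?thesis by (simp add: mult_ac flip: exp_of_nat_mult)
    qed
    also have "real (T j) / (2 ^ j)\<^sup>2 \<le> exp (- (\<delta> / 2) * ln 2) ^ j"
    proof -
      have "(2 ^ j)\<^sup>2 = exp (2 * (real j * ln 2))"
        by (simp only: power_two_eq_exp exp_double)
      then have "real (T j) / (2 ^ j)\<^sup>2 \<le> exp ((2 - \<delta> / 2) * (real j * ln 2)) / exp (2 * (real j * ln 2))"
        using elim by (simp add: divide_right_mono)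
      also have "\<dots> = exp (- (\<delta> / 2) * ln 2) ^ j"
        by (simp add: algebra_simps flip: exp_diff exp_of_nat_mult)
      finally show ?thesis .
    qed
    finally show ?case by simp
  qed
  have "AE \<omega> in M. \<forall>\<^sub>F j in sequentially. \<omega> \<in> space M - F j"
  proof (rule borel_cantelli_AE1)
    show "summable (\<lambda>j. prob (F j))"
    proof (rule summable_comparison_test_ev)
      show "\<forall>\<^sub>F j in sequentially. norm (prob (F j)) \<le> exp (- \<delta> * ln 2) ^ j + exp (- (\<delta> / 2) * ln 2) ^ j"
        using prob_F by simp
      show "summable (\<lambda>j. exp (- \<delta> * ln 2) ^ j + exp (- (\<delta> / 2) * ln 2) ^ j)"
        using \<delta> by (intro summable_add summable_geometric) simp_all
    qed
  qed (use F in \<open>auto simp: emeasure_eq_measure\<close>)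
  then show ?thesis
  proof eventually_elim
    case (elim \<omega>)
    then show ?case using T_le
    proof eventually_elim
      case (elim j)
      show ?case
      proof (intro allI impI)
        fix n assume "exp ((2 - \<delta> / 2) * (real j * ln 2)) \<le> real n"
        then have n: "T j \<le> n" using elim(2) by linarith
        obtain y where y: "y \<in> lattice_ball (2 ^ j)" "k j \<le> local_time X y (T j) \<omega>"
          using elim(1) by (auto simp: F_def not_less)
        then have "k j \<le> local_time X y n \<omega>" using local_time_mono[OF n, of X y \<omega>] by linarith
        then show "\<exists>y\<in>lattice_ball (2 ^ j). (2 - 4 * \<delta>) * walk_lambda M X * (real j * ln 2) - 1 \<le> real (local_time X y n \<omega>)"
          using y(1) k_ge[of j] unfolding \<Lambda>_def[symmetric] by (meson of_nat_le_iff order_trans)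
      qed
    qed
  qed
qed

end

section \<open>Interpolation between dyadic radii\<close>

lemma le_max_local_time_iff:
  assumes "A \<noteq> {}"
  shows "k \<le> max_local_time X A n \<omega> \<longleftrightarrow> (\<exists>x\<in>A. k \<le> local_time X x n \<omega>)"
proof -
  have "local_time X x n \<omega> \<le> n" for x
    unfolding local_time_def using card_mono[of "{1..n}" "{k. 0 < k \<and> k \<le> n \<and> walk X k \<omega> = x}"] by force
  then have "finite ((\<lambda>x. local_time X x n \<omega>) ` A)"
    by (auto intro: finite_subset[OF image_subsetI finite_atMost])
  then show ?thesis unfolding max_local_time_def using assms by (simp add: Max_ge_iff)
qed

lemma zero_mem_lattice_ball: "0 \<le> r \<Longrightarrow> 0 \<in> lattice_ball r"
  by (simp add: lattice_ball_iff)

lemma lattice_ball_mono: "r \<le> s \<Longrightarrow> lattice_ball r \<subseteq> lattice_ball s"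
  by (auto simp: lattice_ball_def)

text \<open>
  For a fixed sample point, \<open>r n\<close> lies between two consecutive powers of 2, and enlarging or
  shrinking the ball to the corresponding dyadic radius changes \<open>log (r n)\<close> by at most \<open>log 2\<close>,
  which is negligible because \<open>log (r n)\<close> tends to infinity. The growth condition ensures that at
  time \<open>n\<close> the walk has made the number of steps that the lower bound asks for. The parameters
  \<open>\<epsilon> = 1/(p+1)\<close> and \<open>\<delta> = 1/(p+5)\<close> run through sequences so that one null set suffices.
\<close>

lemma max_local_time_bounds_imp_tendsto:
  fixes r :: "nat \<Rightarrow> real" and \<Lambda> :: real
  assumes \<Lambda>: "\<Lambda> > 0"
    and r: "filterlim r at_top sequentially"
    and growth: "\<And>\<delta>. 0 < \<delta> \<Longrightarrow> \<delta> < 1/4 \<Longrightarrow> \<forall>\<^sub>F n in sequentially. (2 - \<delta>) * ln (r n) \<le> ln (real n)"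
    and upper: "\<And>p :: nat. \<forall>\<^sub>F j in sequentially. \<forall>n. \<forall>y\<in>lattice_ball (2 ^ j).
       real (local_time X y n \<omega>) \<le> (2 + 1 / real (Suc p)) * \<Lambda> * (real j * ln 2) + 1"
    and lower: "\<And>p :: nat. \<forall>\<^sub>F j in sequentially. \<forall>n. exp ((2 - 1 / real (p + 5) / 2) * (real j * ln 2)) \<le> real n \<longrightarrow>
       (\<exists>y\<in>lattice_ball (2 ^ j). (2 - 4 * (1 / real (p + 5))) * \<Lambda> * (real j * ln 2) - 1 \<le> real (local_time X y n \<omega>))"
  shows "(\<lambda>n. real (max_local_time X (lattice_ball (r n)) n \<omega>) / ln (r n)) \<longlonglongrightarrow> 2 * \<Lambda>"
proof (rule order_tendstoI)
  let ?L = "\<lambda>n. ln (r n)"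
  have L: "filterlim ?L at_top sequentially"
    by (rule filterlim_compose[OF ln_at_top r])
  have r1: "\<forall>\<^sub>F n in sequentially. 1 < r n"
    using r by (rule filterlim_at_top_dense[THEN iffD1, rule_format])
  have vanish: "(\<lambda>n. c / ?L n) \<longlonglongrightarrow> 0" for c
    by (rule real_tendsto_divide_at_top[OF tendsto_const L])
  {
    fix a assume a: "2 * \<Lambda> < a"
    have "(\<lambda>p. (2 + 1 / real (Suc p)) * \<Lambda>) \<longlonglongrightarrow> (2 + 0) * \<Lambda>"
      by (intro tendsto_intros LIMSEQ_Suc[OF lim_1_over_n])
    then have "\<forall>\<^sub>F p in sequentially. (2 + 1 / real (Suc p)) * \<Lambda> < a"
      using a by (intro order_tendstoD(2)) auto
    then obtain p where p: "(2 + 1 / real (Suc p)) * \<Lambda> < a"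
      using eventually_happens by fastforce
    define b where "b = (2 + 1 / real (Suc p)) * \<Lambda>"
    have b: "b > 0" "b < a"
      using \<Lambda> p unfolding b_def by (auto intro!: mult_pos_pos add_pos_nonneg)
    define j where "j n = Suc (nat \<lfloor>?L n / ln 2\<rfloor>)" for n
    have "filterlim (\<lambda>n. \<lfloor>?L n * (1 / ln 2)\<rfloor>) at_top sequentially"
      by (intro filterlim_compose[OF filterlim_floor_sequentially]
            filterlim_at_top_mult_tendsto_pos[OF tendsto_const] L) auto
    then have j: "filterlim j at_top sequentially"
      unfolding j_def
      by (intro filterlim_compose[OF filterlim_Suc] filterlim_compose[OF filterlim_nat_sequentially]) simp
    have ev1: "\<forall>\<^sub>F n in sequentially. \<forall>m. \<forall>y\<in>lattice_ball (2 ^ j n). real (local_time X y m \<omega>) \<le> b * (real (j n) * ln 2) + 1"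
      using eventually_compose_filterlim[OF upper[of p] j] by (simp add: b_def)
    have ev2: "\<forall>\<^sub>F n in sequentially. (b * ln 2 + 1) / ?L n < a - b"
      using vanish b by (intro order_tendstoD(2)) auto
    show "\<forall>\<^sub>F n in sequentially. real (max_local_time X (lattice_ball (r n)) n \<omega>) / ?L n < a"
      using ev1 ev2 r1
    proof eventually_elim
      case (elim n)
      have L0: "?L n > 0" using elim(3) by simp
      have j1: "?L n \<le> real (j n) * ln 2" and j2: "real (j n) * ln 2 \<le> ?L n + ln 2"
      proof -
        have "?L n / ln 2 \<le> real (j n)" unfolding j_def by linarith
        then show "?L n \<le> real (j n) * ln 2" by (simp add: field_simps)
        have "0 \<le> ?L n / ln 2" using L0 by simp
        then have "real (j n) \<le> ?L n / ln 2 + 1" unfolding j_def by linarith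
        then have "real (j n) * ln 2 \<le> (?L n / ln 2 + 1) * ln 2" by (intro mult_right_mono) auto
        then show "real (j n) * ln 2 \<le> ?L n + ln 2" by (simp add: distrib_right)
      qed
      have "r n = exp (?L n)" using elim(3) by simp
      also have "\<dots> \<le> exp (real (j n) * ln 2)" using j1 by simp
      also have "\<dots> = 2 ^ j n" by (simp add: exp_of_nat_mult)
      finally have rj: "r n \<le> 2 ^ j n" .
      have ne: "lattice_ball (r n) \<noteq> {}" using zero_mem_lattice_ball[of "r n"] elim(3) by auto
      obtain y where y: "y \<in> lattice_ball (r n)" "max_local_time X (lattice_ball (r n)) n \<omega> \<le> local_time X y n \<omega>"
        using le_max_local_time_iff[OF ne, of "max_local_time X (lattice_ball (r n)) n \<omega>" X n \<omega>] by auto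
      have "real (max_local_time X (lattice_ball (r n)) n \<omega>) \<le> real (local_time X y n \<omega>)" using y by simp
      also have "\<dots> \<le> b * (real (j n) * ln 2) + 1"
        using elim(1) y(1) lattice_ball_mono[OF rj] by blast
      also have "\<dots> \<le> b * (?L n + ln 2) + 1" using j2 b by (intro add_mono mult_left_mono) auto
      also have "\<dots> = b * ?L n + (b * ln 2 + 1)" by (simp add: distrib_left)
      also have "\<dots> < b * ?L n + (a - b) * ?L n" using elim(2) L0 by (simp add: divide_less_eq)
      finally show ?case using L0 by (simp add: divide_less_eq algebra_simps)
    qed
  next
    fix a assume a: "a < 2 * \<Lambda>"
    have "(\<lambda>p. (2 - 4 * (1 / real (p + 5))) * \<Lambda>) \<longlonglongrightarrow> (2 - 4 * 0) * \<Lambda>"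
      by (intro tendsto_intros LIMSEQ_ignore_initial_segment[OF lim_1_over_n])
    then have "\<forall>\<^sub>F p in sequentially. a < (2 - 4 * (1 / real (p + 5))) * \<Lambda>"
      using a by (intro order_tendstoD(1)) auto
    then obtain p where p: "a < (2 - 4 * (1 / real (p + 5))) * \<Lambda>"
      using eventually_happens by fastforce
    define \<delta> where "\<delta> = 1 / real (p + 5)"
    have \<delta>: "0 < \<delta>" "\<delta> < 1/4" by (simp_all add: \<delta>_def field_simps)
    define b where "b = (2 - 4 * \<delta>) * \<Lambda>"
    have b: "b > 0" "a < b" using \<Lambda> \<delta> p[folded \<delta>_def] by (auto simp: b_def)
    define j where "j n = nat \<lfloor>?L n / ln 2\<rfloor>" for n
    have "filterlim (\<lambda>n. \<lfloor>?L n * (1 / ln 2)\<rfloor>) at_top sequentially"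
      by (intro filterlim_compose[OF filterlim_floor_sequentially]
            filterlim_at_top_mult_tendsto_pos[OF tendsto_const] L) auto
    then have j: "filterlim j at_top sequentially"
      unfolding j_def by (intro filterlim_compose[OF filterlim_nat_sequentially]) simp
    have ev1: "\<forall>\<^sub>F n in sequentially. \<forall>m. exp ((2 - \<delta> / 2) * (real (j n) * ln 2)) \<le> real m \<longrightarrow>
        (\<exists>y\<in>lattice_ball (2 ^ j n). b * (real (j n) * ln 2) - 1 \<le> real (local_time X y m \<omega>))"
      using eventually_compose_filterlim[OF lower[of p] j] by (simp add: b_def \<delta>_def)
    have ev2: "\<forall>\<^sub>F n in sequentially. (b * ln 2 + 1) / ?L n < b - a"
      using vanish b by (intro order_tendstoD(2)) auto
    have ev3: "\<forall>\<^sub>F n in sequentially. (2 - \<delta> / 2) * ?L n \<le> ln (real n)"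
      using \<delta> by (intro growth) auto
    show "\<forall>\<^sub>F n in sequentially. a < real (max_local_time X (lattice_ball (r n)) n \<omega>) / ?L n"
      using ev1 ev2 r1 ev3 eventually_gt_at_top[of 0]
    proof eventually_elim
      case (elim n)
      have L0: "?L n > 0" using elim(3) by simp
      have j1: "real (j n) * ln 2 \<le> ?L n" and j2: "?L n - ln 2 \<le> real (j n) * ln 2"
      proof -
        have "0 \<le> ?L n / ln 2" using L0 by simp
        then have "real (j n) \<le> ?L n / ln 2" unfolding j_def by linarith
        then show "real (j n) * ln 2 \<le> ?L n" by (simp add: field_simps)
        have "?L n / ln 2 - 1 \<le> real (j n)" unfolding j_def by linarith
        then have "(?L n / ln 2 - 1) * ln 2 \<le> real (j n) * ln 2" by (intro mult_right_mono) auto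
        then show "?L n - ln 2 \<le> real (j n) * ln 2" by (simp add: left_diff_distrib)
      qed
      have "2 ^ j n = exp (real (j n) * ln 2)" by (simp add: exp_of_nat_mult)
      also have "\<dots> \<le> exp (?L n)" using j1 by simp
      also have "\<dots> = r n" using elim(3) by simp
      finally have rj: "2 ^ j n \<le> r n" .
      have "(2 - \<delta> / 2) * (real (j n) * ln 2) \<le> (2 - \<delta> / 2) * ?L n"
        using j1 \<delta> by (intro mult_left_mono) auto
      also have "\<dots> \<le> ln (real n)" by (rule elim(4))
      finally have "exp ((2 - \<delta> / 2) * (real (j n) * ln 2)) \<le> exp (ln (real n))" by simp
      then have "exp ((2 - \<delta> / 2) * (real (j n) * ln 2)) \<le> real n" using elim(5) by simp
      then obtain y where y: "y \<in> lattice_ball (2 ^ j n)" "b * (real (j n) * ln 2) - 1 \<le> real (local_time X y n \<omega>)"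
        using elim(1) by blast
      have y': "y \<in> lattice_ball (r n)" using y(1) lattice_ball_mono[OF rj] by blast
      have "a * ?L n = b * ?L n - (b - a) * ?L n" by (simp add: algebra_simps)
      also have "\<dots> < b * ?L n - (b * ln 2 + 1)" using elim(2) L0 by (simp add: divide_less_eq)
      also have "\<dots> = b * (?L n - ln 2) - 1" by (simp add: algebra_simps)
      also have "\<dots> \<le> b * (real (j n) * ln 2) - 1" using j2 b by simp
      also have "\<dots> \<le> real (local_time X y n \<omega>)" by (rule y(2))
      also have "\<dots> \<le> real (max_local_time X (lattice_ball (r n)) n \<omega>)"
        using le_max_local_time_iff[of "lattice_ball (r n)" "local_time X y n \<omega>" X n \<omega>] y' by auto
      finally show ?case using L0 by (simp add: less_divide_eq)
    qed
  }
qed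

lemma ln_growth_of_limsup:
  fixes r :: "nat \<Rightarrow> real"
  assumes "limsup (\<lambda>n. ereal (ln (r n) / ln (real n))) \<le> ereal (1 / 2)" and \<delta>: "0 < \<delta>" "\<delta> < 1/4"
  shows "\<forall>\<^sub>F n in sequentially. (2 - \<delta>) * ln (r n) \<le> ln (real n)"
proof -
  have "ereal (1/2) < ereal (1 / (2 - \<delta>))" using \<delta> by (simp add: field_simps)
  then have "limsup (\<lambda>n. ereal (ln (r n) / ln (real n))) < ereal (1 / (2 - \<delta>))"
    using assms(1) by (rule le_less_trans[rotated])
  then have "\<forall>\<^sub>F n in sequentially. ereal (ln (r n) / ln (real n)) < ereal (1 / (2 - \<delta>))"
    by (rule Limsup_lessD)
  then show ?thesis
    using eventually_gt_at_top[of 1]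
  proof eventually_elim
    case (elim n)
    then have "ln (r n) / ln (real n) < 1 / (2 - \<delta>)" "ln (real n) > 0" by auto
    then show ?case using \<delta> by (simp add: field_simps)
  qed
qed

theorem theorem1p6:
  fixes M :: "'a measure" and X :: "nat \<Rightarrow> 'a \<Rightarrow> int ^ 'd" and r :: "nat \<Rightarrow> real"
  assumes "CARD('d) \<ge> 3"
    and "simple_random_walk M X"
    and "\<And>n. n \<ge> 1 \<Longrightarrow> r n > 0"
    and "mono_on {1..} r"
    and "filterlim r at_top sequentially"
    and "limsup (\<lambda>n. ereal (ln (r n) / ln (real n))) \<le> ereal (1 / 2)"
  shows "AE \<omega> in M.
    (\<lambda>n. real (max_local_time X (lattice_ball (r n)) n \<omega>) / ln (r n))
      \<longlonglongrightarrow> 2 * walk_lambda M X"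
proof -
  interpret simple_random_walk M X by fact
  have "AE \<omega> in M. \<forall>p :: nat. \<forall>\<^sub>F j in sequentially. \<forall>n. \<forall>y\<in>lattice_ball (2 ^ j).
     real (local_time X y n \<omega>) \<le> (2 + 1 / real (Suc p)) * walk_lambda M X * (real j * ln 2) + 1"
    unfolding AE_all_countable by (intro allI AE_local_time_le assms(1)) simp
  moreover have "AE \<omega> in M. \<forall>p :: nat. \<forall>\<^sub>F j in sequentially. \<forall>n.
     exp ((2 - 1 / real (p + 5) / 2) * (real j * ln 2)) \<le> real n \<longrightarrow>
       (\<exists>y\<in>lattice_ball (2 ^ j). (2 - 4 * (1 / real (p + 5))) * walk_lambda M X * (real j * ln 2) - 1
          \<le> real (local_time X y n \<omega>))"
    unfolding AE_all_countable by (intro allI AE_local_time_ge assms(1)) (simp_all add: field_simps)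
  ultimately show ?thesis
  proof eventually_elim
    case (elim \<omega>)
    show ?case
      by (rule max_local_time_bounds_imp_tendsto)
         (use elim ln_return_prob(2)[OF assms(1)] ln_growth_of_limsup[OF assms(6)] assms(5) in auto)
  qed
qed

end
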